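(* Let $\pi\colon P\to M$ be a principal $\mathbb{X}$-bundle for a Lie groupoid $\mathbb{X}=[X_1\rightrightarrows X_0]$ with Lie algebroid $A$, let $d\delta\colon P\times_{X_0}A\to TP$ be the fundamental vector field map, let $\mathbb{H}$ be an Ehresmann connection on $\mathbb{X}$, and let $\lambda^0$, $\tau^0$ be the induced quasi actions on $A$ and $TP$. Then $$d\delta_{pgh}\bigl(\lambda^0_{h^{-1}g^{-1}}(\alpha)-\lambda^0_{h^{-1}}\lambda^0_{g^{-1}}(\alpha)\bigr)=\tau^0_{gh}\bigl(d\delta_p(\alpha)\bigr)-\tau^0_h\tau^0_g\bigl(d\delta_p(\alpha)\bigr)$$ for every $p\in P$ and $g,h\in X_1$ with $a(p)=t(g)$, $s(g)=t(h)$, and every $\alpha\in A_{s(g^{-1})}=\ker(ds)_{1_{s(g^{-1})}}$.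
   Context: Lie groupoid $\mathbb{X}=[X_1\rightrightarrows X_0]$: source $s$, target $t$ are submersions, $gh$ is defined when $s(g)=t(h)$, units $1_x$, inversion $i$. Right action on $P$ with anchor $a\colon P\to X_0$: $pg$ is defined when $a(p)=t(g)$, $a(pg)=s(g)$, $(pg)h=p(gh)$, $p1_{a(p)}=p$; for $(u,\beta)$ tangent to $P\times_{a,X_0,t}X_1$ at $(p,g)$, $u.\beta\in T_{pg}P$ is its image under the differential of the action. Principal $\mathbb{X}$-bundle: a surjective submersion $\pi\colon P\to M$ with a right action, $\pi(pg)=\pi(p)$, and $(p,g)\mapsto(p,pg)$ a diffeomorphism $P\times_{X_0}X_1\to P\times_MP$. $A_x=\ker(ds)_{1_x}$. $r_g\colon A_{t(g)}\to T_gX_1$ is the differential at $1_{t(g)}$ of $h\mapsto hg$; $l_g\colon A_{s(g)}\to T_gX_1$ is the differential at $1_{s(g)}$ of $h\mapsto gh^{-1}$ on $s^{-1}(s(g))$. Ehresmann connection: a subbundle $\mathbb{H}\subset TX_1$ with $TX_1=\mathbb{H}\oplus\ker ds$ and $\mathbb{H}_{1_x}=(d1)_x(T_xX_0)$; $\sigma_g\colon T_{s(g)}X_0\to\mathbb{H}_g$ is the inverse of $ds|_{\mathbb{H}_g}$; $\psi_g\colon T_gX_1\to A_{t(g)}$ satisfies $r_g\psi_g+\sigma_g(ds)_g=\mathrm{Id}$. $\lambda^0_g=-\psi_gl_g\colon A_{s(g)}\to A_{t(g)}$. For $a(p)=t(g)$, $\tau^0_g\colon T_pP\to T_{pg}P$,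 $\tau^0_g(u)=u.(di)_{g^{-1}}\sigma_{g^{-1}}(da)_p(u)$. $d\delta_p\colon A_{a(p)}\to T_pP$ is the differential at $1_{a(p)}$ of $s^{-1}(a(p))\to\pi^{-1}(\pi(p))$, $h\mapsto ph^{-1}$. *)

theory Defs
  imports "HOL-Analysis.Analysis"
begin

primrec Ck_on :: "nat \<Rightarrow> 'a::real_normed_vector set \<Rightarrow> ('a \<Rightarrow> 'b::real_normed_vector) \<Rightarrow> bool" where
  "Ck_on 0 U f \<longleftrightarrow> continuous_on U f"
| "Ck_on (Suc k) U f \<longleftrightarrow>
     f differentiable_on U \<and> (\<forall>v. Ck_on k U (\<lambda>x. frechet_derivative f (at x) v))"

text \<open>Only used for open \<open>U\<close> in finite-dimensional spaces, where continuity of all iterated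
  directional derivatives is continuity of the iterated derivatives.\<close>

definition smooth_on :: "'a::real_normed_vector set \<Rightarrow> ('a \<Rightarrow> 'b::real_normed_vector) \<Rightarrow> bool" where
  "smooth_on U f \<longleftrightarrow> (\<forall>k. Ck_on k U f)"

text \<open>A manifold is given by its topology and an atlas indexed by its points, the chart with
  index \<open>p\<close> being a chart around \<open>p\<close>; the smooth structure is the one generated by this atlas.
  The model space is a finite-dimensional type of class \<open>real_normed_vector\<close>; the class
  \<open>euclidean_space\<close> would exclude manifolds of dimension 0.

  The tangent space at \<open>p\<close> is the model space: a tangent vector is represented by its
  coordinates in the chart with index \<open>p\<close>. Hence differentials are maps between model spaces, and
  the chain rule holds without coordinate changes.\<close>

record ('a, 'e) manifold =
  mtop :: "'a topology"
  chart_dom :: "'a \<Rightarrow> 'a set"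
  chart :: "'a \<Rightarrow> 'a \<Rightarrow> 'e"

definition pts :: "('a, 'e) manifold \<Rightarrow> 'a set" where
  "pts M = topspace (mtop M)"

definition chart_inv :: "('a, 'e) manifold \<Rightarrow> 'a \<Rightarrow> 'e \<Rightarrow> 'a" where
  "chart_inv M p = inv_into (chart_dom M p) (chart M p)"

locale smooth_manifold =
  fixes M :: "('a, 'e::real_normed_vector) manifold"
  assumes hausdorff: "Hausdorff_space (mtop M)"
    and second_countable: "second_countable (mtop M)"
    and finite_dim: "\<exists>B :: 'e set. finite B \<and> span B = UNIV"
    and chart_dom_open: "p \<in> pts M \<Longrightarrow> openin (mtop M) (chart_dom M p)"
    and chart_dom_self: "p \<in> pts M \<Longrightarrow> p \<in> chart_dom M p"
    and chart_image_open: "p \<in> pts M \<Longrightarrow> open (chart M p ` chart_dom M p)"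
    and chart_homeo: "p \<in> pts M \<Longrightarrow>
      homeomorphic_map (subtopology (mtop M) (chart_dom M p))
        (top_of_set (chart M p ` chart_dom M p)) (chart M p)"
    and chart_compat: "p \<in> pts M \<Longrightarrow> q \<in> pts M \<Longrightarrow>
      smooth_on (chart M p ` (chart_dom M p \<inter> chart_dom M q)) (chart M q \<circ> chart_inv M p)"

definition prod_manifold :: "('a, 'e) manifold \<Rightarrow> ('b, 'f) manifold \<Rightarrow> ('a \<times> 'b, 'e \<times> 'f) manifold" where
  "prod_manifold M N =
     \<lparr>mtop = prod_topology (mtop M) (mtop N),
      chart_dom = (\<lambda>p. chart_dom M (fst p) \<times> chart_dom N (snd p)),
      chart = (\<lambda>p x. (chart M (fst p) (fst x), chart N (snd p) (snd x)))\<rparr>"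

definition vec_manifold :: "('e::real_normed_vector, 'e) manifold" where
  "vec_manifold = \<lparr>mtop = euclidean, chart_dom = (\<lambda>_. UNIV), chart = (\<lambda>_ x. x)\<rparr>"

text \<open>\<open>smooth_near M N F p\<close>: \<open>F\<close> is defined and smooth on some open neighbourhood of \<open>p\<close>.\<close>

definition smooth_near ::
    "('a, 'e::real_normed_vector) manifold \<Rightarrow> ('b, 'f::real_normed_vector) manifold \<Rightarrow>
      ('a \<Rightarrow> 'b) \<Rightarrow> 'a \<Rightarrow> bool" where
  "smooth_near M N F p \<longleftrightarrow> p \<in> pts M \<and> F p \<in> pts N \<and>
     (\<exists>W. openin (mtop M) W \<and> p \<in> W \<and> W \<subseteq> chart_dom M p \<and> F ` W \<subseteq> chart_dom N (F p) \<and>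
       smooth_on (chart M p ` W) (chart N (F p) \<circ> F \<circ> chart_inv M p))"

definition differential ::
    "('a, 'e::real_normed_vector) manifold \<Rightarrow> ('b, 'f::real_normed_vector) manifold \<Rightarrow>
      ('a \<Rightarrow> 'b) \<Rightarrow> 'a \<Rightarrow> 'e \<Rightarrow> 'f" where
  "differential M N F p =
     frechet_derivative (chart N (F p) \<circ> F \<circ> chart_inv M p) (at (chart M p p))"

text \<open>Maps defined on a subset \<open>S\<close> of a manifold are smooth if they extend smoothly to a
  neighbourhood of each point of \<open>S\<close>. If \<open>S\<close> is an embedded submanifold (a fibre or a fibre product
  of submersions, say), this is smoothness for the submanifold structure of \<open>S\<close>. The differential
  of such a map is that of any local extension; on vectors tangent to \<open>S\<close>, the only ones it will
  be applied to, it does not depend on the extension.\<close>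

definition local_extension ::
    "('a, 'e::real_normed_vector) manifold \<Rightarrow> ('b, 'f::real_normed_vector) manifold \<Rightarrow>
      'a set \<Rightarrow> ('a \<Rightarrow> 'b) \<Rightarrow> 'a \<Rightarrow> ('a \<Rightarrow> 'b) \<Rightarrow> bool" where
  "local_extension M N S f p F \<longleftrightarrow> smooth_near M N F p \<and>
     (\<exists>W. openin (mtop M) W \<and> p \<in> W \<and> (\<forall>x\<in>S \<inter> W. F x = f x))"

definition smooth_map_on ::
    "('a, 'e::real_normed_vector) manifold \<Rightarrow> ('b, 'f::real_normed_vector) manifold \<Rightarrow>
      'a set \<Rightarrow> ('a \<Rightarrow> 'b) \<Rightarrow> bool" where
  "smooth_map_on M N S f \<longleftrightarrow> (\<forall>p\<in>S. \<exists>F. local_extension M N S f p F)"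

definition differential_on ::
    "('a, 'e::real_normed_vector) manifold \<Rightarrow> ('b, 'f::real_normed_vector) manifold \<Rightarrow>
      'a set \<Rightarrow> ('a \<Rightarrow> 'b) \<Rightarrow> 'a \<Rightarrow> 'e \<Rightarrow> 'f" where
  "differential_on M N S f p = differential M N (SOME F. local_extension M N S f p F) p"

definition diffeomorphism_on ::
    "('a, 'e::real_normed_vector) manifold \<Rightarrow> ('b, 'f::real_normed_vector) manifold \<Rightarrow>
      'a set \<Rightarrow> 'b set \<Rightarrow> ('a \<Rightarrow> 'b) \<Rightarrow> bool" where
  "diffeomorphism_on M N S T f \<longleftrightarrow>
     bij_betw f S T \<and> smooth_map_on M N S f \<and> smooth_map_on N M T (inv_into S f)"

definition submersion ::
    "('a, 'e::real_normed_vector) manifold \<Rightarrow> ('b, 'f::real_normed_vector) manifold \<Rightarrow>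
      ('a \<Rightarrow> 'b) \<Rightarrow> bool" where
  "submersion M N f \<longleftrightarrow>
     smooth_map_on M N (pts M) f \<and> (\<forall>p\<in>pts M. surj (differential M N f p))"

text \<open>On \<open>chart_dom M p\<close>, the map \<open>\<lambda>q. differential M vec_manifold (chart M p) q (V q)\<close> gives the
  components of \<open>V\<close> in the chart with index \<open>p\<close>.\<close>

definition smooth_vector_field_on ::
    "('a, 'e::real_normed_vector) manifold \<Rightarrow> 'a set \<Rightarrow> ('a \<Rightarrow> 'e) \<Rightarrow> bool" where
  "smooth_vector_field_on M W V \<longleftrightarrow>
     (\<forall>p\<in>W. smooth_map_on M vec_manifold (W \<inter> chart_dom M p)
        (\<lambda>q. differential M vec_manifold (chart M p) q (V q)))"

definition smooth_subbundle ::
    "('a, 'e::real_normed_vector) manifold \<Rightarrow> ('a \<Rightarrow> 'e set) \<Rightarrow> bool" where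
  "smooth_subbundle M H \<longleftrightarrow>
     (\<forall>p\<in>pts M. \<exists>W (n::nat) V. openin (mtop M) W \<and> p \<in> W \<and>
        (\<forall>i<n. smooth_vector_field_on M W (V i)) \<and>
        (\<forall>q\<in>W. inj_on (\<lambda>i. V i q) {..<n} \<and> independent ((\<lambda>i. V i q) ` {..<n}) \<and>
                span ((\<lambda>i. V i q) ` {..<n}) = H q))"

record ('x, 'e0, 'g, 'e1) groupoid =
  Obj :: "('x, 'e0) manifold"
  Arr :: "('g, 'e1) manifold"
  src :: "'g \<Rightarrow> 'x"
  tgt :: "'g \<Rightarrow> 'x"
  unit_at :: "'x \<Rightarrow> 'g"
  ginv :: "'g \<Rightarrow> 'g"
  gcomp :: "'g \<Rightarrow> 'g \<Rightarrow> 'g"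

definition fibre_prod :: "'a set \<Rightarrow> ('a \<Rightarrow> 'c) \<Rightarrow> 'b set \<Rightarrow> ('b \<Rightarrow> 'c) \<Rightarrow> ('a \<times> 'b) set" where
  "fibre_prod A f B g = {(x, y). x \<in> A \<and> y \<in> B \<and> f x = g y}"

locale lie_groupoid =
  fixes X :: "('x, 'e0::real_normed_vector, 'g, 'e1::real_normed_vector) groupoid"
  assumes Obj_manifold: "smooth_manifold (Obj X)"
    and Arr_manifold: "smooth_manifold (Arr X)"
    and src_submersion: "submersion (Arr X) (Obj X) (src X)"
    and tgt_submersion: "submersion (Arr X) (Obj X) (tgt X)"
    and unit_smooth: "smooth_map_on (Obj X) (Arr X) (pts (Obj X)) (unit_at X)"
    and ginv_smooth: "smooth_map_on (Arr X) (Arr X) (pts (Arr X)) (ginv X)"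
    and comp_smooth:
      "smooth_map_on (prod_manifold (Arr X) (Arr X)) (Arr X)
         (fibre_prod (pts (Arr X)) (src X) (pts (Arr X)) (tgt X)) (\<lambda>(g, h). gcomp X g h)"
    and src_comp: "g \<in> pts (Arr X) \<Longrightarrow> h \<in> pts (Arr X) \<Longrightarrow> src X g = tgt X h \<Longrightarrow>
      src X (gcomp X g h) = src X h"
    and tgt_comp: "g \<in> pts (Arr X) \<Longrightarrow> h \<in> pts (Arr X) \<Longrightarrow> src X g = tgt X h \<Longrightarrow>
      tgt X (gcomp X g h) = tgt X g"
    and comp_assoc: "g \<in> pts (Arr X) \<Longrightarrow> h \<in> pts (Arr X) \<Longrightarrow> k \<in> pts (Arr X) \<Longrightarrow>
      src X g = tgt X h \<Longrightarrow> src X h = tgt X k \<Longrightarrow>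
      gcomp X (gcomp X g h) k = gcomp X g (gcomp X h k)"
    and src_unit: "x \<in> pts (Obj X) \<Longrightarrow> src X (unit_at X x) = x"
    and tgt_unit: "x \<in> pts (Obj X) \<Longrightarrow> tgt X (unit_at X x) = x"
    and comp_unit_right: "g \<in> pts (Arr X) \<Longrightarrow> gcomp X g (unit_at X (src X g)) = g"
    and comp_unit_left: "g \<in> pts (Arr X) \<Longrightarrow> gcomp X (unit_at X (tgt X g)) g = g"
    and src_ginv: "g \<in> pts (Arr X) \<Longrightarrow> src X (ginv X g) = tgt X g"
    and tgt_ginv: "g \<in> pts (Arr X) \<Longrightarrow> tgt X (ginv X g) = src X g"
    and comp_ginv_right: "g \<in> pts (Arr X) \<Longrightarrow> gcomp X g (ginv X g) = unit_at X (tgt X g)"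
    and comp_ginv_left: "g \<in> pts (Arr X) \<Longrightarrow> gcomp X (ginv X g) g = unit_at X (src X g)"

locale principal_bundle = lie_groupoid X
  for X :: "('x, 'e0::real_normed_vector, 'g, 'e1::real_normed_vector) groupoid" +
  fixes P :: "('p, 'ep::real_normed_vector) manifold"
    and M :: "('m, 'em::real_normed_vector) manifold"
    and \<pi> :: "'p \<Rightarrow> 'm"
    and a :: "'p \<Rightarrow> 'x"
    and act :: "'p \<Rightarrow> 'g \<Rightarrow> 'p"
  assumes P_manifold: "smooth_manifold P"
    and M_manifold: "smooth_manifold M"
    and proj_submersion: "submersion P M \<pi>"
    and proj_surj: "\<pi> ` pts P = pts M"
    and anchor_smooth: "smooth_map_on P (Obj X) (pts P) a"
    and act_smooth:
      "smooth_map_on (prod_manifold P (Arr X)) P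
         (fibre_prod (pts P) a (pts (Arr X)) (tgt X)) (\<lambda>(p, g). act p g)"
    and anchor_act: "p \<in> pts P \<Longrightarrow> g \<in> pts (Arr X) \<Longrightarrow> a p = tgt X g \<Longrightarrow> a (act p g) = src X g"
    and act_comp: "p \<in> pts P \<Longrightarrow> g \<in> pts (Arr X) \<Longrightarrow> h \<in> pts (Arr X) \<Longrightarrow>
      a p = tgt X g \<Longrightarrow> src X g = tgt X h \<Longrightarrow> act (act p g) h = act p (gcomp X g h)"
    and act_unit: "p \<in> pts P \<Longrightarrow> act p (unit_at X (a p)) = p"
    and proj_act: "p \<in> pts P \<Longrightarrow> g \<in> pts (Arr X) \<Longrightarrow> a p = tgt X g \<Longrightarrow> \<pi> (act p g) = \<pi> p"
    and act_principal:
      "diffeomorphism_on (prod_manifold P (Arr X)) (prod_manifold P P)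
         (fibre_prod (pts P) a (pts (Arr X)) (tgt X)) (fibre_prod (pts P) \<pi> (pts P) \<pi>)
         (\<lambda>(p, g). (p, act p g))"

definition algd :: "('x, 'e0::real_normed_vector, 'g, 'e1::real_normed_vector) groupoid \<Rightarrow> 'x \<Rightarrow> 'e1 set" where
  "algd X x = {v. differential (Arr X) (Obj X) (src X) (unit_at X x) v = 0}"

definition src_fibre :: "('x, 'e0, 'g, 'e1) groupoid \<Rightarrow> 'x \<Rightarrow> 'g set" where
  "src_fibre X x = {h \<in> pts (Arr X). src X h = x}"

definition right_transl ::
    "('x, 'e0::real_normed_vector, 'g, 'e1::real_normed_vector) groupoid \<Rightarrow> 'g \<Rightarrow> 'e1 \<Rightarrow> 'e1" where
  "right_transl X g =
     differential_on (Arr X) (Arr X) (src_fibre X (tgt X g)) (\<lambda>h. gcomp X h g) (unit_at X (tgt X g))"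

definition left_transl ::
    "('x, 'e0::real_normed_vector, 'g, 'e1::real_normed_vector) groupoid \<Rightarrow> 'g \<Rightarrow> 'e1 \<Rightarrow> 'e1" where
  "left_transl X g =
     differential_on (Arr X) (Arr X) (src_fibre X (src X g)) (\<lambda>h. gcomp X g (ginv X h)) (unit_at X (src X g))"

locale ehresmann_connection =
  fixes X :: "('x, 'e0::real_normed_vector, 'g, 'e1::real_normed_vector) groupoid"
    and H :: "'g \<Rightarrow> 'e1 set"
  assumes subbundle: "smooth_subbundle (Arr X) H"
    and complement_Int: "g \<in> pts (Arr X) \<Longrightarrow>
      H g \<inter> {v. differential (Arr X) (Obj X) (src X) g v = 0} = {0}"
    and complement_sum: "g \<in> pts (Arr X) \<Longrightarrow>
      {u + v | u v. u \<in> H g \<and> differential (Arr X) (Obj X) (src X) g v = 0} = UNIV"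
    and at_unit: "x \<in> pts (Obj X) \<Longrightarrow> H (unit_at X x) = range (differential (Obj X) (Arr X) (unit_at X) x)"

definition hor_lift ::
    "('x, 'e0::real_normed_vector, 'g, 'e1::real_normed_vector) groupoid \<Rightarrow> ('g \<Rightarrow> 'e1 set) \<Rightarrow>
      'g \<Rightarrow> 'e0 \<Rightarrow> 'e1" where
  "hor_lift X H g w = (THE v. v \<in> H g \<and> differential (Arr X) (Obj X) (src X) g v = w)"

definition conn_form ::
    "('x, 'e0::real_normed_vector, 'g, 'e1::real_normed_vector) groupoid \<Rightarrow> ('g \<Rightarrow> 'e1 set) \<Rightarrow>
      'g \<Rightarrow> 'e1 \<Rightarrow> 'e1" where
  "conn_form X H g v =
     (THE \<alpha>. \<alpha> \<in> algd X (tgt X g) \<and>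
        right_transl X g \<alpha> + hor_lift X H g (differential (Arr X) (Obj X) (src X) g v) = v)"

definition quasi_algd ::
    "('x, 'e0::real_normed_vector, 'g, 'e1::real_normed_vector) groupoid \<Rightarrow> ('g \<Rightarrow> 'e1 set) \<Rightarrow>
      'g \<Rightarrow> 'e1 \<Rightarrow> 'e1" where
  "quasi_algd X H g \<alpha> = - conn_form X H g (left_transl X g \<alpha>)"

definition tangent_act ::
    "('x, 'e0::real_normed_vector, 'g, 'e1::real_normed_vector) groupoid \<Rightarrow>
      ('p, 'ep::real_normed_vector) manifold \<Rightarrow> ('p \<Rightarrow> 'x) \<Rightarrow> ('p \<Rightarrow> 'g \<Rightarrow> 'p) \<Rightarrow>
      'p \<Rightarrow> 'g \<Rightarrow> 'ep \<Rightarrow> 'e1 \<Rightarrow> 'ep" where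
  "tangent_act X P a act p g u \<beta> =
     differential_on (prod_manifold P (Arr X)) P
       (fibre_prod (pts P) a (pts (Arr X)) (tgt X)) (\<lambda>(p, g). act p g) (p, g) (u, \<beta>)"

text \<open>The map \<open>T\<^sub>p P \<Rightarrow> T\<^sub>p\<^sub>g P\<close> induced by an arrow \<open>g\<close>; the base point \<open>p\<close> is an explicit argument.\<close>

definition quasi_tangent ::
    "('x, 'e0::real_normed_vector, 'g, 'e1::real_normed_vector) groupoid \<Rightarrow> ('g \<Rightarrow> 'e1 set) \<Rightarrow>
      ('p, 'ep::real_normed_vector) manifold \<Rightarrow> ('p \<Rightarrow> 'x) \<Rightarrow> ('p \<Rightarrow> 'g \<Rightarrow> 'p) \<Rightarrow>
      'p \<Rightarrow> 'g \<Rightarrow> 'ep \<Rightarrow> 'ep" where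
  "quasi_tangent X H P a act p g u =
     tangent_act X P a act p g u
       (differential (Arr X) (Arr X) (ginv X) (ginv X g)
          (hor_lift X H (ginv X g) (differential P (Obj X) a p u)))"

definition fund_vf ::
    "('x, 'e0::real_normed_vector, 'g, 'e1::real_normed_vector) groupoid \<Rightarrow>
      ('p, 'ep::real_normed_vector) manifold \<Rightarrow> ('p \<Rightarrow> 'x) \<Rightarrow> ('p \<Rightarrow> 'g \<Rightarrow> 'p) \<Rightarrow>
      'p \<Rightarrow> 'e1 \<Rightarrow> 'ep" where
  "fund_vf X P a act p =
     differential_on (Arr X) P (src_fibre X (a p)) (\<lambda>h. act p (ginv X h)) (unit_at X (a p))"

end

theory Submission
  imports Defs
begin

text \<open>The map \<open>d\<delta>\<close> intertwines the two quasi actions exactly: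
  \<open>d\<delta>\<^bsub>pg\<^esub> (\<lambda>\<^sup>0\<^bsub>g'\<^esub> \<alpha>) = \<tau>\<^sup>0\<^bsub>g\<^esub> (d\<delta>\<^bsub>p\<^esub> \<alpha>)\<close> with \<open>g' = g\<^sup>-\<^sup>1\<close>. Three uses of this identity, at the
  arrows \<open>gh\<close>, \<open>g\<close> and \<open>h\<close>, and linearity of \<open>d\<delta>\<close> give the theorem. For the identity, put
  \<open>\<psi> = \<psi>\<^bsub>g'\<^esub> (l\<^bsub>g'\<^esub> \<alpha>)\<close>; then \<open>\<sigma>\<^bsub>g'\<^esub> (da (d\<delta>\<^bsub>p\<^esub> \<alpha>)) = l\<^bsub>g'\<^esub> \<alpha> - r\<^bsub>g'\<^esub> \<psi>\<close>, so that
  \<open>\<tau>\<^sup>0\<^bsub>g\<^esub> (d\<delta>\<^bsub>p\<^esub> \<alpha>) = (d\<delta>\<^bsub>p\<^esub> \<alpha>).di(l\<^bsub>g'\<^esub> \<alpha>) - 0.di(r\<^bsub>g'\<^esub> \<psi>)\<close>. The first term is the velocity of a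
  constant curve and the second one is \<open>d\<delta>\<^bsub>pg\<^esub> \<psi>\<close>.

  Differentials are computed on velocities of curves. As \<open>differential_on\<close> chooses an arbitrary
  extension, every vector of \<open>ker ds\<close> has to be the velocity of a curve inside a source fibre;
  such curves come from the contraction principle.\<close>

section \<open>Finite-dimensional normed spaces\<close>

text \<open>Plays the role of a basis with continuous coordinates. The model spaces carry only a
  norm, so boundedness of the coordinate functionals is recorded explicitly.\<close>

definition finite_coords :: "'a::real_normed_vector set \<Rightarrow> ('a \<Rightarrow> 'a \<Rightarrow> real) \<Rightarrow> bool" where
  "finite_coords B \<phi> \<longleftrightarrow> finite B \<and> (\<forall>b\<in>B. bounded_linear (\<phi> b)) \<and>
     (\<forall>v. (\<Sum>b\<in>B. \<phi> b v *\<^sub>R b) = v)"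

text \<open>The l1 norm of the coefficients is dominated by the given norm. Induction on
  \<open>B\<close>: by the bound for \<open>B\<close>, the coefficients of a Cauchy sequence in
  \<open>span B\<close> are Cauchy, so the span contains its limits and the new vector
  \<open>a\<close> has a positive distance \<open>d\<close> from it.\<close>

lemma independent_norm_lower_bound:
  fixes B :: "'a::real_normed_vector set"
  assumes "finite B" "independent B"
  shows "\<exists>e>0. \<forall>c. e * (\<Sum>b\<in>B. \<bar>c b\<bar>) \<le> norm (\<Sum>b\<in>B. c b *\<^sub>R b)"
  using assms
proof (induction B rule: finite_induct)
  case empty
  then show ?case by (auto intro: exI[of _ 1])
next
  case (insert a B)
  have indB: "independent B" and a: "a \<notin> span B"
    using insert.prems insert.hyps by (auto simp: independent_insert)
  obtain e where e: "e > 0" "\<And>c. e * (\<Sum>b\<in>B. \<bar>c b\<bar>) \<le> norm (\<Sum>b\<in>B. c b *\<^sub>R b)"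
    using insert.IH[OF indB] by blast
  have "\<exists>d>0. \<forall>c. d \<le> norm (a + (\<Sum>b\<in>B. c b *\<^sub>R b))"
  proof (rule ccontr)
    assume "\<not> ?thesis"
    then have "\<exists>c. norm (a + (\<Sum>b\<in>B. c b *\<^sub>R b)) < inverse (real (Suc n))" for n
      by (metis not_le of_nat_0_less_iff positive_imp_inverse_positive zero_less_Suc)
    then obtain c where c: "\<And>n. norm (a + (\<Sum>b\<in>B. c n b *\<^sub>R b)) < inverse (real (Suc n))"
      by metis
    let ?s = "\<lambda>n. \<Sum>b\<in>B. c n b *\<^sub>R b"
    have lim: "(\<lambda>n. a + ?s n) \<longlonglongrightarrow> 0"
      by (rule tendsto_norm_zero_cancel, rule Lim_null_comparison[OF _ LIMSEQ_inverse_real_of_nat])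
        (use c in \<open>auto intro!: always_eventually less_imp_le\<close>)
    have "?s \<longlonglongrightarrow> -a"
      using tendsto_add[OF lim tendsto_const[of "-a"]] by simp
    then have Cs: "Cauchy ?s"
      by (rule LIMSEQ_imp_Cauchy)
    have "\<exists>l. (\<lambda>n. c n b) \<longlonglongrightarrow> l" if b: "b \<in> B" for b
    proof -
      have "Cauchy (\<lambda>n. c n b)"
        unfolding Cauchy_def
      proof (intro allI impI)
        fix r :: real assume r: "r > 0"
        obtain N where N: "\<And>m n. m \<ge> N \<Longrightarrow> n \<ge> N \<Longrightarrow> dist (?s m) (?s n) < e * r"
          using Cs e(1) r unfolding Cauchy_def by (meson mult_pos_pos)
        have "dist (c m b) (c n b) < r" if "m \<ge> N" "n \<ge> N" for m n
        proof -
          have "e * \<bar>c m b - c n b\<bar> \<le> e * (\<Sum>b\<in>B. \<bar>c m b - c n b\<bar>)"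
            using e(1) b insert.hyps(1) by (intro mult_left_mono member_le_sum) auto
          also have "\<dots> \<le> norm (\<Sum>b\<in>B. (c m b - c n b) *\<^sub>R b)"
            by (rule e(2))
          also have "\<dots> = dist (?s m) (?s n)"
            by (simp add: dist_norm sum_subtractf scaleR_diff_left)
          also have "\<dots> < e * r"
            by (rule N[OF that])
          finally show ?thesis
            using e(1) by (simp add: dist_real_def)
        qed
        then show "\<exists>N. \<forall>m\<ge>N. \<forall>n\<ge>N. dist (c m b) (c n b) < r"
          by blast
      qed
      then show ?thesis
        using real_Cauchy_convergent convergent_def by blast
    qed
    then obtain l where "\<And>b. b \<in> B \<Longrightarrow> (\<lambda>n. c n b) \<longlonglongrightarrow> l b"
      by metis
    then have "?s \<longlonglongrightarrow> (\<Sum>b\<in>B. l b *\<^sub>R b)"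
      by (intro tendsto_sum tendsto_scaleR tendsto_const) auto
    with \<open>?s \<longlonglongrightarrow> -a\<close> have "-a = (\<Sum>b\<in>B. l b *\<^sub>R b)"
      by (rule LIMSEQ_unique)
    then have "-a \<in> span B"
      by (auto intro: span_sum span_scale span_base)
    then show False
      using a span_neg by fastforce
  qed
  then obtain d where d: "d > 0" "\<And>c. d \<le> norm (a + (\<Sum>b\<in>B. c b *\<^sub>R b))"
    by blast
  \<comment> \<open>The coefficient of \<open>a\<close> is at most \<open>?N / d\<close>, by
    homogeneity. The other ones are bounded through \<open>e\<close> after subtracting
    \<open>c a\<close> times \<open>a\<close>, which costs the term with
    \<open>norm a / d\<close>.\<close>
  define K where "K = 1 / d + (1 + norm a / d) / e"
  have K: "K > 0"
    using d(1) e(1) by (simp add: K_def add_pos_nonneg)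
  have "(\<Sum>b\<in>insert a B. \<bar>c b\<bar>) \<le> K * norm (\<Sum>b\<in>insert a B. c b *\<^sub>R b)" for c
  proof -
    let ?S = "\<Sum>b\<in>B. c b *\<^sub>R b" and ?N = "norm (c a *\<^sub>R a + (\<Sum>b\<in>B. c b *\<^sub>R b))"
    have 1: "\<bar>c a\<bar> \<le> ?N / d"
    proof (cases "c a = 0")
      case False
      have "\<bar>c a\<bar> * d \<le> \<bar>c a\<bar> * norm (a + (\<Sum>b\<in>B. (c b / c a) *\<^sub>R b))"
        by (intro mult_left_mono d(2)) auto
      also have "\<dots> = norm (c a *\<^sub>R (a + (\<Sum>b\<in>B. (c b / c a) *\<^sub>R b)))"
        by simp
      also have "\<dots> = ?N"
        using False by (simp add: scaleR_add_right scaleR_sum_right)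
      finally show ?thesis
        using d(1) by (simp add: field_simps)
    qed (use d(1) in auto)
    have "e * (\<Sum>b\<in>B. \<bar>c b\<bar>) \<le> norm ?S"
      by (rule e(2))
    also have "\<dots> \<le> ?N + \<bar>c a\<bar> * norm a"
      using norm_triangle_ineq4[of "c a *\<^sub>R a + ?S" "c a *\<^sub>R a"] by simp
    also have "\<dots> \<le> ?N + ?N / d * norm a"
      using 1 by (intro add_left_mono mult_right_mono) auto
    finally have 2: "(\<Sum>b\<in>B. \<bar>c b\<bar>) \<le> (?N + ?N / d * norm a) / e"
      using e(1) by (simp add: field_simps)
    have "(\<Sum>b\<in>insert a B. \<bar>c b\<bar>) \<le> ?N / d + (?N + ?N / d * norm a) / e"
      using insert.hyps 1 2 by simp
    also have "\<dots> = K * ?N"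
      using d(1) e(1) by (simp add: K_def field_simps)
    finally show ?thesis
      using insert.hyps by simp
  qed
  then show ?case
    using K by (intro exI[of _ "1 / K"]) (auto simp: field_simps)
qed

text \<open>A basis is extracted from the finite spanning set;
  \<open>independent_norm_lower_bound\<close> is what makes its coordinate functionals
  bounded.\<close>

lemma finite_coords_exist:
  assumes "\<exists>B :: 'a::real_normed_vector set. finite B \<and> span B = UNIV"
  shows "\<exists>B (\<phi> :: 'a \<Rightarrow> 'a \<Rightarrow> real). finite_coords B \<phi>"
proof -
  obtain A :: "'a set" where A: "finite A" "span A = UNIV"
    using assms by blast
  obtain B where B: "B \<subseteq> A" "independent B" "A \<subseteq> span B"
    using maximal_independent_subset by blast
  have fin: "finite B"
    using A(1) B(1) finite_subset by blast
  have span: "span B = UNIV"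
    using A(2) B(3) by (metis span_mono span_span top.extremum_unique)
  obtain e where e: "e > 0" "\<And>c. e * (\<Sum>b\<in>B. \<bar>c b\<bar>) \<le> norm (\<Sum>b\<in>B. c b *\<^sub>R b)"
    using independent_norm_lower_bound[OF fin B(2)] by blast
  define \<phi> where "\<phi> = (\<lambda>b v. representation B v b)"
  have rep: "(\<Sum>b\<in>B. \<phi> b v *\<^sub>R b) = v" for v
    unfolding \<phi>_def using real_vector.sum_representation_eq[OF B(2) _ fin order_refl] span by auto
  have "bounded_linear (\<phi> b)" if b: "b \<in> B" for b
  proof (rule bounded_linear_intro[where K = "1 / e"])
    show "\<phi> b (x + y) = \<phi> b x + \<phi> b y" for x y
      unfolding \<phi>_def using real_vector.representation_add[OF B(2)] span by auto
    show "\<phi> b (r *\<^sub>R x) = r *\<^sub>R \<phi> b x" for r x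
      unfolding \<phi>_def using real_vector.representation_scale[OF B(2)] span by auto
    show "norm (\<phi> b x) \<le> norm x * (1 / e)" for x
    proof -
      have "e * \<bar>\<phi> b x\<bar> \<le> e * (\<Sum>b\<in>B. \<bar>\<phi> b x\<bar>)"
        using e(1) b fin by (intro mult_left_mono member_le_sum) auto
      also have "\<dots> \<le> norm x"
        using e(2)[of "\<lambda>b. \<phi> b x"] by (simp add: rep)
      finally show ?thesis
        using e(1) by (simp add: field_simps)
    qed
  qed
  then have "finite_coords B \<phi>"
    using fin rep by (simp add: finite_coords_def)
  then show ?thesis by blast
qed

lemma finite_coords_linear:
  fixes f :: "'a::real_normed_vector \<Rightarrow> 'b::real_normed_vector" and B :: "'a set"
  assumes "finite_coords B \<phi>" "linear f"
  shows "f v = (\<Sum>b\<in>B. \<phi> b v *\<^sub>R f b)"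
proof -
  have "f v = f (\<Sum>b\<in>B. \<phi> b v *\<^sub>R b)"
    using assms(1) by (simp add: finite_coords_def)
  then show ?thesis
    by (simp add: linear_sum[OF assms(2)] linear_scale[OF assms(2)])
qed

lemma finite_coords_bounded_linear:
  fixes f :: "'a::real_normed_vector \<Rightarrow> 'b::real_normed_vector" and B :: "'a set"
  assumes "finite_coords B \<phi>" "linear f"
  shows "bounded_linear f"
proof -
  have "bounded_linear (\<lambda>v. \<Sum>b\<in>B. \<phi> b v *\<^sub>R f b)"
    using assms(1) by (intro bounded_linear_sum bounded_linear_scaleR_left[THEN bounded_linear_compose])
      (auto simp: finite_coords_def)
  then show ?thesis
    by (simp add: finite_coords_linear[OF assms, symmetric])
qed

text \<open>Completeness is required for the contraction principle in
  \<open>level_set_curve\<close>, whose fixed points lie in a closed ball of a model space.\<close>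

lemma finite_coords_complete:
  assumes "finite_coords (B :: 'a::real_normed_vector set) \<phi>"
  shows "complete (UNIV :: 'a set)"
proof -
  have "convergent x" if "Cauchy x" for x :: "nat \<Rightarrow> 'a"
  proof -
    have "(\<lambda>n. \<phi> b (x n)) \<longlonglongrightarrow> lim (\<lambda>n. \<phi> b (x n))" if "b \<in> B" for b
      using bounded_linear.Cauchy[OF _ \<open>Cauchy x\<close>] assms that
      by (auto simp: finite_coords_def convergent_LIMSEQ_iff[symmetric] intro: real_Cauchy_convergent)
    then have "(\<lambda>n. \<Sum>b\<in>B. \<phi> b (x n) *\<^sub>R b) \<longlonglongrightarrow> (\<Sum>b\<in>B. lim (\<lambda>n. \<phi> b (x n)) *\<^sub>R b)"
      by (intro tendsto_sum tendsto_scaleR tendsto_const) auto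
    then show ?thesis
      using assms by (auto simp: finite_coords_def convergent_def)
  qed
  then show ?thesis
    by (auto simp: complete_def convergent_def)
qed

lemma finite_dim_Times:
  fixes B :: "'a::real_normed_vector set" and C :: "'b::real_normed_vector set"
  assumes B: "finite B" "span B = UNIV" and C: "finite C" "span C = UNIV"
  shows "\<exists>D :: ('a \<times> 'b) set. finite D \<and> span D = UNIV"
proof (intro exI conjI)
  let ?D = "(\<lambda>x. (x, 0)) ` B \<union> (\<lambda>y. (0, y)) ` C"
  show "finite ?D"
    using B C by simp
  have l1: "linear (\<lambda>x::'a. (x, 0::'b))" and l2: "linear (\<lambda>y::'b. (0::'a, y))"
    by (auto intro!: linearI)
  have "(x, y) \<in> span ?D" for x y
  proof -
    have "(x, 0) \<in> span ?D"
      using linear_span_image[OF l1, of B] B(2) span_mono[of "(\<lambda>x. (x, 0)) ` B" ?D] by fastforce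
    moreover have "(0, y) \<in> span ?D"
      using linear_span_image[OF l2, of C] C(2) span_mono[of "(\<lambda>y. (0, y)) ` C" ?D] by fastforce
    ultimately show ?thesis
      using span_add by fastforce
  qed
  then show "span ?D = UNIV"
    by auto
qed

section \<open>Continuously differentiable functions\<close>

lemma Ck_on_cong:
  assumes "open U" "\<And>x. x \<in> U \<Longrightarrow> f x = g x" "Ck_on k U f"
  shows "Ck_on k U g"
  using assms(2,3)
proof (induction k arbitrary: f g)
  case 0
  then show ?case by (simp cong: continuous_on_cong)
next
  case (Suc k)
  have "g differentiable (at x)" if x: "x \<in> U" for x
  proof -
    have "(f has_derivative frechet_derivative f (at x)) (at x)"
      using Suc.prems(2) x by (simp add: differentiable_on_eq_differentiable_at[OF assms(1)] frechet_derivative_works[symmetric])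
    from has_derivative_transform_within_open[OF this assms(1) x Suc.prems(1)]
    show ?thesis by (auto simp: differentiable_def)
  qed
  then have d: "g differentiable_on U"
    by (simp add: differentiable_on_eq_differentiable_at[OF assms(1)])
  have eq: "frechet_derivative f (at x) = frechet_derivative g (at x)" if "x \<in> U" for x
    using Suc.prems that assms(1) differentiable_on_eq_differentiable_at[OF assms(1)]
    by (intro frechet_derivative_transform_within_open[OF _ assms(1)]) auto
  have "Ck_on k U (\<lambda>x. frechet_derivative g (at x) v)" for v
    using Suc.IH[of "\<lambda>x. frechet_derivative f (at x) v" "\<lambda>x. frechet_derivative g (at x) v"] Suc.prems eq
    by simp
  with d show ?case by simp
qed

lemma Ck_on_subset: "Ck_on k U f \<Longrightarrow> V \<subseteq> U \<Longrightarrow> Ck_on k V f"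
  by (induction k arbitrary: f) (auto intro: continuous_on_subset differentiable_on_subset)

lemma Ck_on_Suc_imp: "Ck_on (Suc k) U f \<Longrightarrow> Ck_on k U f"
  by (induction k arbitrary: f) (auto intro: differentiable_imp_continuous_on)

lemma Ck_on_Suc_has_derivative:
  assumes "open U" "Ck_on (Suc k) U f" "x \<in> U"
  shows "(f has_derivative frechet_derivative f (at x)) (at x)"
  using assms by (auto simp: differentiable_on_eq_differentiable_at frechet_derivative_works[symmetric])

text \<open>Allows a derivative \<open>D\<close> in closed form: derivatives are unique and
  \<open>U\<close> is open, so \<open>Ck_on_cong\<close> can exchange \<open>D\<close> for
  \<open>frechet_derivative\<close>.\<close>

lemma Ck_on_SucI:
  assumes U: "open U" and D: "\<And>x. x \<in> U \<Longrightarrow> (f has_derivative D x) (at x)"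
    and C: "\<And>v. Ck_on k U (\<lambda>x. D x v)"
  shows "Ck_on (Suc k) U f"
proof -
  have "f differentiable_on U"
    using D U by (auto simp: differentiable_on_eq_differentiable_at differentiable_def)
  moreover have "Ck_on k U (\<lambda>x. frechet_derivative f (at x) v)" for v
    by (rule Ck_on_cong[OF U _ C[of v]]) (simp add: frechet_derivative_at[OF D])
  ultimately show ?thesis by simp
qed

lemma Ck_on_const: "open U \<Longrightarrow> Ck_on k U (\<lambda>x. c)"
proof (induction k arbitrary: c)
  case (Suc k)
  show ?case
    by (rule Ck_on_SucI[OF Suc.prems, where D = "\<lambda>x v. 0"]) (auto intro: Suc)
qed simp

lemma Ck_on_bounded_linear:
  assumes "bounded_linear L" "open U" "Ck_on k U f"
  shows "Ck_on k U (\<lambda>x. L (f x))"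
  using assms(3)
proof (induction k arbitrary: f)
  case 0
  then show ?case
    using assms(1) by (auto intro: bounded_linear.continuous_on)
next
  case (Suc k)
  show ?case
  proof (rule Ck_on_SucI[OF assms(2)])
    show "((\<lambda>x. L (f x)) has_derivative (\<lambda>v. L (frechet_derivative f (at x) v))) (at x)" if "x \<in> U" for x
      by (rule bounded_linear.has_derivative[OF assms(1) Ck_on_Suc_has_derivative[OF assms(2) Suc.prems that]])
    show "Ck_on k U (\<lambda>x. L (frechet_derivative f (at x) v))" for v
      using Suc by simp
  qed
qed

lemma Ck_on_ident: "open U \<Longrightarrow> Ck_on k U (\<lambda>x. x)"
proof (cases k)
  case (Suc m)
  assume "open U"
  then show ?thesis
    unfolding Suc
    by (intro Ck_on_SucI[where D = "\<lambda>x v. v"] Ck_on_const) (auto intro: has_derivative_ident)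
qed simp

lemma Ck_on_add:
  assumes "open U" "Ck_on k U f" "Ck_on k U g"
  shows "Ck_on k U (\<lambda>x. f x + g x)"
  using assms(2,3)
proof (induction k arbitrary: f g)
  case 0
  then show ?case by (simp add: continuous_on_add)
next
  case (Suc k)
  show ?case
    by (rule Ck_on_SucI[OF assms(1) has_derivative_add[OF
          Ck_on_Suc_has_derivative[OF assms(1) Suc.prems(1)]
          Ck_on_Suc_has_derivative[OF assms(1) Suc.prems(2)]]])
      (use Suc in auto)
qed

lemma Ck_on_sum:
  assumes "open U" "\<And>i. i \<in> I \<Longrightarrow> Ck_on k U (f i)"
  shows "Ck_on k U (\<lambda>x. \<Sum>i\<in>I. f i x)"
  using assms(2)
  by (induction I rule: infinite_finite_induct) (auto intro: Ck_on_const Ck_on_add assms(1))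

lemma Ck_on_scaleR:
  assumes "open U" "Ck_on k U f" "Ck_on k U g"
  shows "Ck_on k U (\<lambda>x. f x *\<^sub>R g x)"
  using assms(2,3)
proof (induction k arbitrary: f g)
  case 0
  then show ?case by (simp add: continuous_on_scaleR)
next
  case (Suc k)
  show ?case
  proof (rule Ck_on_SucI[OF assms(1) has_derivative_scaleR[OF
          Ck_on_Suc_has_derivative[OF assms(1) Suc.prems(1)]
          Ck_on_Suc_has_derivative[OF assms(1) Suc.prems(2)]]])
    show "Ck_on k U (\<lambda>x. f x *\<^sub>R frechet_derivative g (at x) v + frechet_derivative f (at x) v *\<^sub>R g x)" for v
      using Suc.prems by (intro Ck_on_add assms(1) Suc.IH) (auto intro: Ck_on_Suc_imp)
  qed
qed

lemma Ck_on_Pair: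
  fixes f :: "'a::real_normed_vector \<Rightarrow> 'b::real_normed_vector"
    and g :: "'a \<Rightarrow> 'c::real_normed_vector"
  assumes "open U" "Ck_on k U f" "Ck_on k U g"
  shows "Ck_on k U (\<lambda>x. (f x, g x))"
proof -
  have "bounded_linear (\<lambda>y::'b. (y, 0::'c))" "bounded_linear (\<lambda>z::'c. (0::'b, z))"
    by (intro bounded_linear_Pair bounded_linear_ident bounded_linear_zero)+
  from Ck_on_add[OF assms(1) Ck_on_bounded_linear[OF this(1) assms(1,2)]
      Ck_on_bounded_linear[OF this(2) assms(1,3)]]
  show ?thesis by simp
qed

text \<open>The chain rule applies the derivative of \<open>g\<close> to a direction that varies
  with \<open>x\<close>, while \<open>Ck_on\<close> speaks of fixed directions only. Expanding the
  varying direction in the coordinates \<open>\<phi>\<close> leaves finitely many fixed directions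
  with coefficients of class \<open>k\<close>; the induction hypothesis is used for these
  directional derivatives in place of \<open>g\<close>.\<close>

lemma Ck_on_compose:
  fixes f :: "'a::real_normed_vector \<Rightarrow> 'b::real_normed_vector"
    and g :: "'b \<Rightarrow> 'c::real_normed_vector" and B :: "'b set"
  assumes \<phi>: "finite_coords B \<phi>" and U: "open U" and V: "open V" and UV: "f ` U \<subseteq> V"
  shows "Ck_on k U f \<Longrightarrow> Ck_on k V g \<Longrightarrow> Ck_on k U (g \<circ> f)"
proof (induction k arbitrary: g)
  case 0
  then show ?case
    using UV by (auto intro: continuous_on_compose2)
next
  case (Suc k)
  have f': "(f has_derivative frechet_derivative f (at x)) (at x)" if "x \<in> U" for x
    using Ck_on_Suc_has_derivative[OF U Suc.prems(1) that] .
  have g': "(g has_derivative frechet_derivative g (at (f x))) (at (f x))" if "x \<in> U" for x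
    using Ck_on_Suc_has_derivative[OF V Suc.prems(2)] that UV by blast
  show ?case
  proof (rule Ck_on_SucI[OF U, where D = "\<lambda>x. frechet_derivative g (at (f x)) \<circ> frechet_derivative f (at x)"])
    show "(g \<circ> f has_derivative frechet_derivative g (at (f x)) \<circ> frechet_derivative f (at x)) (at x)"
      if "x \<in> U" for x
      by (rule diff_chain_at[OF f'[OF that] g'[OF that]])
    fix v
    have "Ck_on k U (\<lambda>x. \<Sum>b\<in>B. \<phi> b (frechet_derivative f (at x) v) *\<^sub>R
        ((\<lambda>y. frechet_derivative g (at y) b) \<circ> f) x)"
    proof (intro Ck_on_sum Ck_on_scaleR U)
      show "Ck_on k U (\<lambda>x. \<phi> b (frechet_derivative f (at x) v))" if "b \<in> B" for b
        using that \<phi> Suc.prems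
        by (intro Ck_on_bounded_linear[where L = "\<phi> b", OF _ U]) (auto simp: finite_coords_def)
      show "Ck_on k U ((\<lambda>y. frechet_derivative g (at y) b) \<circ> f)" for b
        using Suc.prems Ck_on_Suc_imp[OF Suc.prems(1)] by (intro Suc.IH) auto
    qed
    then show "Ck_on k U (\<lambda>x. (frechet_derivative g (at (f x)) \<circ> frechet_derivative f (at x)) v)"
    proof (rule Ck_on_cong[OF U, rotated])
      fix x assume "x \<in> U"
      then have "linear (frechet_derivative g (at (f x)))"
        by (rule has_derivative_linear[OF g'])
      from finite_coords_linear[OF \<phi> this, symmetric]
      show "(\<Sum>b\<in>B. \<phi> b (frechet_derivative f (at x) v) *\<^sub>R
          ((\<lambda>y. frechet_derivative g (at y) b) \<circ> f) x) =
          (frechet_derivative g (at (f x)) \<circ> frechet_derivative f (at x)) v"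
        by simp
    qed
  qed
qed

section \<open>Curves in level sets\<close>

text \<open>Strict differentiability of a function of class 1: near \<open>z\<close> the derivative
  differs little from the one at \<open>z\<close> in operator norm, and the mean value inequality
  applies to \<open>f\<close> minus its linear part at \<open>z\<close>.\<close>

lemma strict_derivative:
  fixes f :: "'a::real_normed_vector \<Rightarrow> 'b::real_normed_vector" and B :: "'a set"
  assumes \<phi>: "finite_coords B \<phi>" and U: "open U" and f: "Ck_on (Suc 0) U f" and z: "z \<in> U" and e: "e > 0"
  shows "\<exists>r>0. ball z r \<subseteq> U \<and> (\<forall>x\<in>ball z r. \<forall>y\<in>ball z r.
    norm (f x - f y - frechet_derivative f (at z) (x - y)) \<le> e * norm (x - y))"
proof -
  let ?D = "\<lambda>x. frechet_derivative f (at x)"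
  \<comment> \<open>\<open>s x\<close> bounds the operator norm of \<open>?D x - ?D z\<close>. It is
    continuous because only the finitely many directions in \<open>B\<close> occur in it.\<close>
  define s where "s = (\<lambda>x. \<Sum>b\<in>B. onorm (\<phi> b) * norm (?D x b - ?D z b))"
  have "continuous_on U s"
    unfolding s_def using f by (intro continuous_intros) auto
  then have "open (s -` {..<e} \<inter> U)"
    using U continuous_on_open_vimage open_lessThan by blast
  moreover have "z \<in> s -` {..<e} \<inter> U"
    using z e by (simp add: s_def)
  ultimately obtain r where r: "r > 0" "ball z r \<subseteq> s -` {..<e} \<inter> U"
    by (meson openE)
  have D: "(f has_derivative ?D x) (at x)" if "x \<in> U" for x
    using Ck_on_Suc_has_derivative[OF U f that] .
  have on: "onorm (\<lambda>v. ?D x v - ?D z v) \<le> e" if x: "x \<in> ball z r" for x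
  proof (rule onorm_bound)
    show "0 \<le> e"
      using e by simp
    fix v
    have "x \<in> U"
      using x r(2) by blast
    then have lin: "linear (\<lambda>v. ?D x v - ?D z v)"
      by (intro linear_compose_sub has_derivative_linear[OF D] z)
    have "norm (?D x v - ?D z v) = norm (\<Sum>b\<in>B. \<phi> b v *\<^sub>R (?D x b - ?D z b))"
      by (subst finite_coords_linear[OF \<phi> lin]) (rule refl)
    also have "\<dots> \<le> (\<Sum>b\<in>B. \<bar>\<phi> b v\<bar> * norm (?D x b - ?D z b))"
      by (rule order_trans[OF norm_sum]) simp
    also have "\<dots> \<le> (\<Sum>b\<in>B. (onorm (\<phi> b) * norm v) * norm (?D x b - ?D z b))"
      using \<phi> onorm[of "\<phi> b" v for b] by (intro sum_mono mult_right_mono) (auto simp: finite_coords_def)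
    also have "\<dots> = s x * norm v"
      unfolding s_def sum_distrib_right by (intro sum.cong) auto
    also have "\<dots> \<le> e * norm v"
      using x r by (intro mult_right_mono) (auto intro: less_imp_le)
    finally show "norm (?D x v - ?D z v) \<le> e * norm v" .
  qed
  have bl: "bounded_linear (?D z)"
    using D[OF z] by (rule has_derivative_bounded_linear)
  have "norm (f x - f y - ?D z (x - y)) \<le> e * norm (x - y)"
    if "x \<in> ball z r" "y \<in> ball z r" for x y
  proof -
    have "norm ((f x - ?D z x) - (f y - ?D z y)) \<le> e * norm (x - y)"
    proof (rule differentiable_bound[OF convex_ball _ on that])
      fix x assume "x \<in> ball z r"
      then have "((\<lambda>x. f x - ?D z x) has_derivative (\<lambda>v. ?D x v - ?D z v)) (at x)"
        using r by (intro has_derivative_diff D bounded_linear.has_derivative[OF bl] has_derivative_ident) auto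
      then show "((\<lambda>x. f x - ?D z x) has_derivative (\<lambda>v. ?D x v - ?D z v)) (at x within ball z r)"
        by (rule has_derivative_at_withinI)
    qed
    then show ?thesis
      by (simp add: linear_diff[OF bounded_linear.linear[OF bl]] algebra_simps)
  qed
  then show ?thesis
    using r by blast
qed

text \<open>A curve version of the implicit function theorem, with regularity claimed at 0 only. The
  curve is \<open>z\<close> plus \<open>t\<close> times \<open>v\<close> plus a correction
  \<open>R (c t)\<close>, where \<open>R\<close> is a linear right inverse of the derivative. The
  contraction principle provides \<open>c t\<close>, and strict differentiability shows that it is
  of order o(t), so that the velocity at 0 is \<open>v\<close>.\<close>

lemma level_set_curve:
  fixes f :: "'a::real_normed_vector \<Rightarrow> 'b::real_normed_vector"
    and B :: "'a set" and C :: "'b set"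
  assumes \<phi>: "finite_coords B \<phi>" and \<psi>: "finite_coords C \<psi>"
    and U: "open U" and f: "Ck_on (Suc 0) U f" and z: "z \<in> U"
    and surj: "surj (frechet_derivative f (at z))" and v: "frechet_derivative f (at z) v = 0"
  shows "\<exists>w. w 0 = z \<and> (\<forall>\<^sub>F t in nhds (0::real). w t \<in> U \<and> f (w t) = f z) \<and>
    (w has_vector_derivative v) (at 0)"
proof -
  define L where "L = frechet_derivative f (at z)"
  have L: "linear L"
    using Ck_on_Suc_has_derivative[OF U f z] unfolding L_def by (rule has_derivative_linear)
  obtain R where R: "linear R" and LR': "L \<circ> R = id"
    using real_vector.linear_surjective_right_inverse[OF L] surj unfolding L_def by blast
  have LR: "L (R c) = c" for c
    using LR' by (metis comp_apply id_apply)
  \<comment> \<open>Since \<open>v\<close> lies in the kernel, \<open>L\<close> recovers the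
    correction \<open>c\<close> from the displacement.\<close>
  have Lw: "L (t *\<^sub>R v + R c) = c" for t c
    using v unfolding L_def[symmetric] by (simp add: linear_add[OF L] linear_scale[OF L] LR)
  obtain K where K: "K > 0" "\<And>c. norm (R c) \<le> K * norm c"
    using bounded_linear.pos_bounded[OF finite_coords_bounded_linear[OF \<psi> R]]
    by (metis mult.commute)
  have step: "norm (t *\<^sub>R v + R c) \<le> \<bar>t\<bar> * norm v + K * norm c" for t c
    by (rule order_trans[OF norm_triangle_ineq]) (use K(2) in simp)
  \<comment> \<open>Differences of the map \<open>T\<close> below are linearisation errors of
    \<open>f\<close> between points whose distance is at most \<open>K\<close> times that of the
    arguments. With this \<open>e\<close> the contraction factor \<open>e * K\<close> is one
    half.\<close>
  define e where "e = 1 / (2 * K)"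
  have e: "e > 0" "e * K = 1 / 2"
    using K(1) by (auto simp: e_def)
  obtain r where r: "r > 0" "ball z r \<subseteq> U" and
    strict: "\<And>x y. x \<in> ball z r \<Longrightarrow> y \<in> ball z r \<Longrightarrow> norm (f x - f y - L (x - y)) \<le> e * norm (x - y)"
    using strict_derivative[OF \<phi> U f z e(1)] unfolding L_def by blast
  define \<rho> where "\<rho> = r / (4 * K)"
  have \<rho>: "\<rho> > 0" "K * \<rho> = r / 4"
    using r(1) K(1) by (auto simp: \<rho>_def)
  \<comment> \<open>\<open>\<rho>\<close> keeps the part \<open>R c\<close> of the displacement
    below \<open>r / 4\<close>. The two terms of the minimum keep the part along \<open>v\<close>
    below \<open>r / 4\<close>, so that points stay in the ball, and make \<open>T\<close> map the
    ball of radius \<open>\<rho>\<close> into itself. The summand 1 covers the case of zero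
    \<open>v\<close>.\<close>
  define d where "d = min (r / 4) (\<rho> / (2 * e)) / (norm v + 1)"
  have d: "d > 0"
    using r(1) \<rho>(1) e(1) by (simp add: d_def add_nonneg_pos)
  have small: "\<bar>t\<bar> * norm v \<le> r / 4" "e * (\<bar>t\<bar> * norm v) \<le> \<rho> / 2" if t: "\<bar>t\<bar> < d" for t
  proof -
    have "\<bar>t\<bar> * norm v \<le> d * (norm v + 1)"
      using t d by (intro mult_mono) auto
    also have "\<dots> = min (r / 4) (\<rho> / (2 * e))"
      unfolding d_def using add_nonneg_pos[OF norm_ge_zero[of v] zero_less_one] by (simp add: field_simps)
    finally have *: "\<bar>t\<bar> * norm v \<le> min (r / 4) (\<rho> / (2 * e))" .
    then show "\<bar>t\<bar> * norm v \<le> r / 4" by simp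
    show "e * (\<bar>t\<bar> * norm v) \<le> \<rho> / 2"
      using * e(1) by (simp add: field_simps)
  qed
  have "\<exists>c. norm c \<le> 2 * e * \<bar>t\<bar> * norm v \<and> z + (t *\<^sub>R v + R c) \<in> ball z r \<and>
      f (z + (t *\<^sub>R v + R c)) = f z" if t: "\<bar>t\<bar> < d" for t
  proof -
    define w where "w = (\<lambda>c. z + (t *\<^sub>R v + R c))"
    \<comment> \<open>\<open>w c\<close> is on the level set iff \<open>c\<close> is a fixed point of this simplified Newton map.\<close>
    define T where "T = (\<lambda>c. c - (f (w c) - f z))"
    have wb: "w c \<in> ball z r" if "c \<in> cball 0 \<rho>" for c
    proof -
      have "norm (t *\<^sub>R v + R c) \<le> \<bar>t\<bar> * norm v + K * \<rho>"
        by (rule order_trans[OF step]) (use that K(1) in auto)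
      then have "norm (t *\<^sub>R v + R c) < r"
        using small(1)[OF t] \<rho>(2) r(1) by linarith
      then show ?thesis
        by (simp add: w_def dist_norm del: minus_add_distrib)
    qed
    have zb: "z \<in> ball z r"
      using r by simp
    have Tb: "norm (T c) \<le> e * (\<bar>t\<bar> * norm v) + norm c / 2" if c: "c \<in> cball 0 \<rho>" for c
    proof -
      have "norm (T c) = norm (f (w c) - f z - L (w c - z))"
        by (simp add: T_def w_def Lw norm_minus_commute)
      also have "\<dots> \<le> e * norm (w c - z)"
        by (rule strict[OF wb[OF c] zb])
      also have "\<dots> \<le> e * (\<bar>t\<bar> * norm v + K * norm c)"
        using e(1) step by (intro mult_left_mono) (auto simp: w_def)
      also have "\<dots> = e * (\<bar>t\<bar> * norm v) + (e * K) * norm c"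
        by (simp add: algebra_simps)
      finally show ?thesis
        by (simp add: e(2))
    qed
    have "\<exists>!c\<in>cball 0 \<rho>. T c = c"
    proof (rule Banach_fix[where c = "1/2"])
      show "complete (cball (0::'b) \<rho>)"
        using complete_closed_subset[OF closed_cball _ finite_coords_complete[OF \<psi>]] by blast
      show "cball (0::'b) \<rho> \<noteq> {}"
        using \<rho>(1) by auto
      show "T ` cball 0 \<rho> \<subseteq> cball 0 \<rho>"
      proof
        fix y assume "y \<in> T ` cball 0 \<rho>"
        then obtain c where c: "c \<in> cball 0 \<rho>" "y = T c" by blast
        then show "y \<in> cball 0 \<rho>"
          using Tb[OF c(1)] small(2)[OF t] by simp
      qed
      show "dist (T x) (T y) \<le> 1 / 2 * dist x y" if "x \<in> cball 0 \<rho>" "y \<in> cball 0 \<rho>" for x y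
      proof -
        have wxy: "w x - w y = R (x - y)"
          by (simp add: w_def linear_diff[OF R])
        have "T x - T y = - (f (w x) - f (w y) - L (w x - w y))"
          by (simp add: T_def wxy LR)
        then have "dist (T x) (T y) = norm (f (w x) - f (w y) - L (w x - w y))"
          by (metis dist_norm norm_minus_cancel)
        also have "\<dots> \<le> e * norm (w x - w y)"
          by (rule strict[OF wb[OF that(1)] wb[OF that(2)]])
        also have "\<dots> \<le> e * (K * norm (x - y))"
          using e(1) K(2) by (intro mult_left_mono) (auto simp: wxy)
        also have "\<dots> = (e * K) * norm (x - y)" by simp
        finally show ?thesis
          by (simp add: e(2) dist_norm)
      qed
    qed auto
    then obtain c where c: "c \<in> cball 0 \<rho>" "T c = c" by blast
    \<comment> \<open>At a fixed point, half of \<open>norm c\<close> on the right-hand side of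
      \<open>Tb\<close> is absorbed on the left.\<close>
    have "norm c \<le> 2 * e * \<bar>t\<bar> * norm v"
      using Tb[OF c(1)] c(2) by simp
    moreover have "f (w c) = f z"
      using c(2) by (simp add: T_def)
    ultimately show ?thesis
      using wb[OF c(1)] unfolding w_def by blast
  qed
  then obtain c where c: "\<And>t. \<bar>t\<bar> < d \<Longrightarrow> norm (c t) \<le> 2 * e * \<bar>t\<bar> * norm v"
    and w: "\<And>t. \<bar>t\<bar> < d \<Longrightarrow> z + (t *\<^sub>R v + R (c t)) \<in> ball z r"
      "\<And>t. \<bar>t\<bar> < d \<Longrightarrow> f (z + (t *\<^sub>R v + R (c t))) = f z"
    by metis
  define w where "w = (\<lambda>t. z + (t *\<^sub>R v + R (c t)))"
  have c0: "c 0 = 0"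
    using c[of 0] d by simp
  have w0: "w 0 = z"
    by (simp add: w_def c0 linear_0[OF R])
  have ev: "\<forall>\<^sub>F t in nhds (0::real). w t \<in> U \<and> f (w t) = f z"
    unfolding eventually_nhds_metric using d w r(2) by (auto simp: w_def dist_real_def intro!: exI[of _ d])
  \<comment> \<open>One \<open>norm v\<close> stems from the displacement along \<open>v\<close>,
    the other one from the correction, since \<open>2 * e * K\<close> is 1.\<close>
  define N where "N = norm v + norm v"
  have wz: "norm (w t - z) \<le> N * \<bar>t\<bar>" if "\<bar>t\<bar> < d" for t
  proof -
    have "norm (w t - z) \<le> \<bar>t\<bar> * norm v + K * norm (c t)"
      using step by (simp add: w_def)
    also have "\<dots> \<le> \<bar>t\<bar> * norm v + K * (2 * e * \<bar>t\<bar> * norm v)"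
      using K(1) c[OF that] by (intro add_left_mono mult_left_mono) auto
    also have "\<dots> = \<bar>t\<bar> * norm v + 2 * (e * K) * (\<bar>t\<bar> * norm v)"
      by (simp add: algebra_simps)
    also have "\<dots> = N * \<bar>t\<bar>"
      unfolding e(2) N_def by (simp add: algebra_simps)
    finally show ?thesis .
  qed
  have N: "N \<ge> 0"
    by (simp add: N_def)
  \<comment> \<open>So far the correction is only of order O(t). As \<open>f (w t) = f z\<close>,
    the linearisation error of \<open>f\<close> between \<open>w t\<close> and \<open>z\<close> has
    norm exactly \<open>norm (c t)\<close>; estimating it with arbitrarily small constants near
    \<open>z\<close> improves the order to o(t).\<close>
  have "(w has_derivative (\<lambda>t. t *\<^sub>R v)) (at 0)"
    unfolding has_derivative_at_alt
  proof (intro conjI allI impI)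
    show "bounded_linear (\<lambda>t::real. t *\<^sub>R v)"
      by (rule bounded_linear_scaleR_left)
    fix \<epsilon> :: real assume \<epsilon>: "\<epsilon> > 0"
    define \<eta> where "\<eta> = \<epsilon> / (K * (N + 1))"
    have "N + 1 > 0"
      using N by simp
    then have \<eta>: "\<eta> > 0" "K * \<eta> * (N + 1) = \<epsilon>"
      using \<epsilon> K(1) by (auto simp: \<eta>_def)
    obtain s where s: "s > 0" "ball z s \<subseteq> U" and
      strict': "\<And>x y. x \<in> ball z s \<Longrightarrow> y \<in> ball z s \<Longrightarrow> norm (f x - f y - L (x - y)) \<le> \<eta> * norm (x - y)"
      using strict_derivative[OF \<phi> U f z \<eta>(1)] unfolding L_def by blast
    \<comment> \<open>Below \<open>m\<close> the curve is given by the fixed points, and the bound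
      \<open>wz\<close> places \<open>w t\<close> in the ball of radius \<open>s\<close>.\<close>
    define m where "m = min d (s / (N + 1))"
    have m: "m > 0"
      using d s(1) N by (simp add: m_def)
    have "norm (w t - w 0 - (t - 0) *\<^sub>R v) \<le> \<epsilon> * norm (t - 0)" if t: "norm (t - 0) < m" for t
    proof -
      have td: "\<bar>t\<bar> < d" and "\<bar>t\<bar> * (N + 1) < s"
        using t N s(1) by (auto simp: m_def field_simps)
      then have "norm (w t - z) < s"
        using wz[OF td] by (simp add: algebra_simps)
      then have "w t \<in> ball z s" "z \<in> ball z s"
        using s(1) by (auto simp: dist_norm norm_minus_commute)
      from strict'[OF this] have "norm (f (w t) - f z - L (w t - z)) \<le> \<eta> * norm (w t - z)" .
      then have "norm (c t) \<le> \<eta> * norm (w t - z)"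
        using w(2)[OF td] by (simp add: w_def Lw)
      also have "\<dots> \<le> \<eta> * ((N + 1) * \<bar>t\<bar>)"
        using \<eta>(1) wz[OF td] by (intro mult_left_mono) (auto simp: algebra_simps)
      finally have ct: "norm (c t) \<le> \<eta> * ((N + 1) * \<bar>t\<bar>)" .
      have "norm (w t - w 0 - (t - 0) *\<^sub>R v) = norm (R (c t))"
        by (simp add: w0) (simp add: w_def)
      also have "\<dots> \<le> K * (\<eta> * ((N + 1) * \<bar>t\<bar>))"
        by (rule order_trans[OF K(2)]) (use ct K(1) in simp)
      also have "\<dots> = K * \<eta> * (N + 1) * \<bar>t\<bar>"
        by simp
      also have "\<dots> = \<epsilon> * norm (t - 0)"
        unfolding \<eta>(2) by simp
      finally show ?thesis .
    qed
    then show "\<exists>d>0. \<forall>y. norm (y - 0) < d \<longrightarrow> norm (w y - w 0 - (y - 0) *\<^sub>R v) \<le> \<epsilon> * norm (y - 0)"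
      using m by blast
  qed
  then show ?thesis
    using w0 ev unfolding has_vector_derivative_def by blast
qed

section \<open>Smooth maps between manifolds\<close>

text \<open>Without compatibility of the charts, the axioms pass to products at once; the proof never
  changes charts.\<close>

locale charted_manifold =
  fixes M :: "('a, 'e::real_normed_vector) manifold"
  assumes model_finite_dim: "\<exists>B :: 'e set. finite B \<and> span B = UNIV"
    and dom_open: "p \<in> pts M \<Longrightarrow> openin (mtop M) (chart_dom M p)"
    and dom_self: "p \<in> pts M \<Longrightarrow> p \<in> chart_dom M p"
    and image_open: "p \<in> pts M \<Longrightarrow> open (chart M p ` chart_dom M p)"
    and homeo: "p \<in> pts M \<Longrightarrow>
      homeomorphic_map (subtopology (mtop M) (chart_dom M p))
        (top_of_set (chart M p ` chart_dom M p)) (chart M p)"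
begin

lemma dom_subset: "p \<in> pts M \<Longrightarrow> chart_dom M p \<subseteq> pts M"
  using dom_open openin_subset unfolding pts_def by blast

lemma chart_inj: "p \<in> pts M \<Longrightarrow> inj_on (chart M p) (chart_dom M p)"
  using homeomorphic_imp_injective_map[OF homeo] dom_subset
  by (metis inf.absorb2 pts_def topspace_subtopology)

lemma chart_inv_chart: "p \<in> pts M \<Longrightarrow> x \<in> chart_dom M p \<Longrightarrow> chart_inv M p (chart M p x) = x"
  unfolding chart_inv_def by (simp add: chart_inj)

text \<open>A chart is a homeomorphism between open sets, so openness in the manifold can be tested
  in the model space, where the analysis takes place.\<close>

lemma openin_iff_chart:
  assumes "p \<in> pts M" "V \<subseteq> chart_dom M p"
  shows "openin (mtop M) V \<longleftrightarrow> open (chart M p ` V)"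
proof -
  have "openin (mtop M) V \<longleftrightarrow> openin (subtopology (mtop M) (chart_dom M p)) V"
    using assms dom_open by (simp add: openin_open_subtopology)
  also have "\<dots> \<longleftrightarrow> openin (top_of_set (chart M p ` chart_dom M p)) (chart M p ` V)"
    using assms dom_subset[OF assms(1)]
    by (subst homeomorphic_map_openness_eq[OF homeo[OF assms(1)]]) (auto simp: pts_def)
  also have "\<dots> \<longleftrightarrow> open (chart M p ` V)"
    using assms image_open by (auto simp: openin_open_eq image_mono)
  finally show ?thesis .
qed

end

lemma (in smooth_manifold) charted: "charted_manifold M"
  by unfold_locales (fact finite_dim chart_dom_open chart_dom_self chart_image_open chart_homeo)+

lemma charted_prod:
  fixes M :: "('a, 'e::real_normed_vector) manifold" and N :: "('b, 'f::real_normed_vector) manifold"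
  assumes "charted_manifold M" "charted_manifold N"
  shows "charted_manifold (prod_manifold M N)"
proof -
  interpret M: charted_manifold M by fact
  interpret N: charted_manifold N by fact
  have img: "chart (prod_manifold M N) p ` chart_dom (prod_manifold M N) p =
      (chart M (fst p) ` chart_dom M (fst p)) \<times> (chart N (snd p) ` chart_dom N (snd p))" for p
    unfolding image_paired_Times[symmetric] by (simp add: prod_manifold_def case_prod_unfold)
  have mem: "fst p \<in> pts M" "snd p \<in> pts N" if "p \<in> pts (prod_manifold M N)" for p
    using that by (auto simp: pts_def prod_manifold_def)
  show ?thesis
  proof
    show "\<exists>B :: ('e \<times> 'f) set. finite B \<and> span B = UNIV"
      using M.model_finite_dim N.model_finite_dim finite_dim_Times by metis
    fix p assume p: "p \<in> pts (prod_manifold M N)"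
    note mem = mem[OF p]
    show "openin (mtop (prod_manifold M N)) (chart_dom (prod_manifold M N) p)"
      using mem M.dom_open N.dom_open by (simp add: prod_manifold_def openin_prod_Times_iff)
    show "p \<in> chart_dom (prod_manifold M N) p"
      using mem M.dom_self N.dom_self by (simp add: prod_manifold_def mem_Times_iff)
    show "open (chart (prod_manifold M N) p ` chart_dom (prod_manifold M N) p)"
      unfolding img using mem M.image_open N.image_open by (simp add: open_Times)
    have "homeomorphic_map
        (prod_topology (subtopology (mtop M) (chart_dom M (fst p))) (subtopology (mtop N) (chart_dom N (snd p))))
        (prod_topology (top_of_set (chart M (fst p) ` chart_dom M (fst p)))
          (top_of_set (chart N (snd p) ` chart_dom N (snd p))))
        (\<lambda>(x, y). (chart M (fst p) x, chart N (snd p) y))"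
      using M.homeo[OF mem(1)] N.homeo[OF mem(2)] by (metis homeomorphic_maps_prod homeomorphic_map_maps)
    then show "homeomorphic_map
        (subtopology (mtop (prod_manifold M N)) (chart_dom (prod_manifold M N) p))
        (top_of_set (chart (prod_manifold M N) p ` chart_dom (prod_manifold M N) p))
        (chart (prod_manifold M N) p)"
      unfolding img by (simp add: prod_manifold_def subtopology_Times[symmetric] case_prod_unfold)
  qed
qed

text \<open>Continuity of \<open>F\<close> is not part of \<open>smooth_near\<close>. It comes from
  continuity of the coordinate expression: the part of \<open>W\<close> that \<open>F\<close> sends
  into \<open>V\<close> corresponds to an open set in the chart.\<close>

lemma smooth_near_shrink:
  assumes "charted_manifold M" "charted_manifold N" and F: "smooth_near M N F p"
    and V: "openin (mtop N) V" "F p \<in> V" and V': "openin (mtop M) V'" "p \<in> V'"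
  obtains W where "openin (mtop M) W" "p \<in> W" "W \<subseteq> chart_dom M p" "W \<subseteq> V'" "F ` W \<subseteq> chart_dom N (F p)"
    "F ` W \<subseteq> V" "open (chart M p ` W)" "smooth_on (chart M p ` W) (chart N (F p) \<circ> F \<circ> chart_inv M p)"
proof -
  interpret M: charted_manifold M by fact
  interpret N: charted_manifold N by fact
  have p: "p \<in> pts M" and q: "F p \<in> pts N"
    using F by (auto simp: smooth_near_def)
  obtain W where W: "openin (mtop M) W" "p \<in> W" "W \<subseteq> chart_dom M p" "F ` W \<subseteq> chart_dom N (F p)"
    and sm: "smooth_on (chart M p ` W) (chart N (F p) \<circ> F \<circ> chart_inv M p)"
    using F by (auto simp: smooth_near_def)
  define f where "f = chart N (F p) \<circ> F \<circ> chart_inv M p"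
  define V1 where "V1 = chart N (F p) ` (V \<inter> chart_dom N (F p))"
  have "open V1"
    unfolding V1_def using V N.dom_open[OF q] by (subst N.openin_iff_chart[OF q, symmetric]) auto
  moreover have "open (chart M p ` W)"
    using W M.openin_iff_chart[OF p] by blast
  moreover have "continuous_on (chart M p ` W) f"
    using sm unfolding smooth_on_def f_def by (metis Ck_on.simps(1))
  ultimately have "open (f -` V1 \<inter> chart M p ` W)"
    using continuous_on_open_vimage by blast
  moreover have "f -` V1 \<inter> chart M p ` W = chart M p ` {x \<in> W. F x \<in> V}"
  proof -
    have "f (chart M p x) \<in> V1 \<longleftrightarrow> F x \<in> V" if "x \<in> W" for x
    proof -
      have "f (chart M p x) = chart N (F p) (F x)"
        using that W(3) M.chart_inv_chart[OF p] by (auto simp: f_def)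
      moreover have "F x \<in> chart_dom N (F p)"
        using that W(4) by blast
      ultimately show ?thesis
        unfolding V1_def using inj_onD[OF N.chart_inj[OF q]] by auto
    qed
    then show ?thesis by auto
  qed
  ultimately have "open (chart M p ` {x \<in> W. F x \<in> V})"
    by simp
  then have W1: "openin (mtop M) {x \<in> W. F x \<in> V}"
    using M.openin_iff_chart[OF p, of "{x \<in> W. F x \<in> V}"] W(3) by auto
  let ?W = "{x \<in> W. F x \<in> V} \<inter> V'"
  have o: "openin (mtop M) ?W"
    using W1 V'(1) by (rule openin_Int)
  show thesis
  proof (rule that[of ?W])
    show "open (chart M p ` ?W)"
      using M.openin_iff_chart[OF p, of ?W] o W(3) by auto
    show "smooth_on (chart M p ` ?W) (chart N (F p) \<circ> F \<circ> chart_inv M p)"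
      using sm unfolding smooth_on_def by (blast intro: Ck_on_subset)
  qed (use o W V V' in auto)
qed

text \<open>Both coordinate expressions use the chart of \<open>N\<close> with index
  \<open>F p\<close>, so on a shrunken neighbourhood their composite is the expression of the
  composite map, without any transition map.\<close>

lemma smooth_near_compose:
  fixes M :: "('a, 'e::real_normed_vector) manifold" and N :: "('b, 'f::real_normed_vector) manifold"
    and K :: "('c, 'g::real_normed_vector) manifold"
  assumes M: "charted_manifold M" and N: "charted_manifold N"
    and F: "smooth_near M N F p" and G: "smooth_near N K G (F p)"
  shows "smooth_near M K (G \<circ> F) p"
proof -
  interpret M: charted_manifold M by fact
  interpret N: charted_manifold N by fact
  have p: "p \<in> pts M" and q: "F p \<in> pts N" and r: "G (F p) \<in> pts K"
    using F G by (auto simp: smooth_near_def)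
  obtain V where V: "openin (mtop N) V" "F p \<in> V" "V \<subseteq> chart_dom N (F p)" "G ` V \<subseteq> chart_dom K (G (F p))"
    and smG: "smooth_on (chart N (F p) ` V) (chart K (G (F p)) \<circ> G \<circ> chart_inv N (F p))"
    using G by (auto simp: smooth_near_def)
  obtain W where W: "openin (mtop M) W" "p \<in> W" "W \<subseteq> chart_dom M p" "F ` W \<subseteq> V" "open (chart M p ` W)"
    and smF: "smooth_on (chart M p ` W) (chart N (F p) \<circ> F \<circ> chart_inv M p)"
    using smooth_near_shrink[OF M N F V(1,2) M.dom_open[OF p] M.dom_self[OF p]] by metis
  define f where "f = chart N (F p) \<circ> F \<circ> chart_inv M p"
  define g where "g = chart K (G (F p)) \<circ> G \<circ> chart_inv N (F p)"
  have f: "f (chart M p x) = chart N (F p) (F x)" if "x \<in> W" for x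
    using that W(3) M.chart_inv_chart[OF p] by (auto simp: f_def)
  have oV: "open (chart N (F p) ` V)"
    using V N.openin_iff_chart[OF q] by blast
  have UV: "f ` (chart M p ` W) \<subseteq> chart N (F p) ` V"
    using f W(4) by auto
  obtain B and \<phi> :: "'f \<Rightarrow> 'f \<Rightarrow> real" where \<phi>: "finite_coords B \<phi>"
    using finite_coords_exist[OF N.model_finite_dim] by blast
  have "Ck_on k (chart M p ` W) (chart K ((G \<circ> F) p) \<circ> (G \<circ> F) \<circ> chart_inv M p)" for k
  proof (rule Ck_on_cong[OF W(5)])
    show "Ck_on k (chart M p ` W) (g \<circ> f)"
      using smF smG by (intro Ck_on_compose[OF \<phi> W(5) oV UV]) (auto simp: smooth_on_def f_def g_def)
    fix x assume "x \<in> chart M p ` W"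
    then obtain y where y: "y \<in> W" "x = chart M p y" by blast
    have "chart_inv N (F p) (chart N (F p) (F y)) = F y"
      using y(1) W(4) V(3) by (intro N.chart_inv_chart[OF q]) auto
    then show "(g \<circ> f) x = (chart K ((G \<circ> F) p) \<circ> (G \<circ> F) \<circ> chart_inv M p) x"
      using y W(3) M.chart_inv_chart[OF p] by (auto simp: f_def g_def)
  qed
  then have "smooth_on (chart M p ` W) (chart K ((G \<circ> F) p) \<circ> (G \<circ> F) \<circ> chart_inv M p)"
    by (simp add: smooth_on_def)
  moreover have "(G \<circ> F) ` W \<subseteq> chart_dom K ((G \<circ> F) p)"
    using W(4) V(4) by auto
  ultimately show ?thesis
    unfolding smooth_near_def using p r W(1-3) by auto
qed

lemma smooth_near_Pair:
  fixes M :: "('a, 'e::real_normed_vector) manifold" and N :: "('b, 'f::real_normed_vector) manifold"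
    and K :: "('c, 'g::real_normed_vector) manifold"
  assumes "charted_manifold M" and F: "smooth_near M N F p" and G: "smooth_near M K G p"
  shows "smooth_near M (prod_manifold N K) (\<lambda>x. (F x, G x)) p"
proof -
  interpret M: charted_manifold M by fact
  have p: "p \<in> pts M" and q: "F p \<in> pts N" and r: "G p \<in> pts K"
    using F G by (auto simp: smooth_near_def)
  obtain V where V: "openin (mtop M) V" "p \<in> V" "V \<subseteq> chart_dom M p" "G ` V \<subseteq> chart_dom K (G p)"
    and smG: "smooth_on (chart M p ` V) (chart K (G p) \<circ> G \<circ> chart_inv M p)"
    using G by (auto simp: smooth_near_def)
  obtain W where W: "openin (mtop M) W" "p \<in> W" "W \<subseteq> chart_dom M p" "F ` W \<subseteq> chart_dom N (F p)"
    and smF: "smooth_on (chart M p ` W) (chart N (F p) \<circ> F \<circ> chart_inv M p)"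
    using F by (auto simp: smooth_near_def)
  have o: "openin (mtop M) (V \<inter> W)"
    using V W by auto
  then have U: "open (chart M p ` (V \<inter> W))"
    using M.openin_iff_chart[OF p, of "V \<inter> W"] V(3) by auto
  have "Ck_on k (chart M p ` (V \<inter> W))
      (\<lambda>x. ((chart N (F p) \<circ> F \<circ> chart_inv M p) x, (chart K (G p) \<circ> G \<circ> chart_inv M p) x))" for k
    using smF smG unfolding smooth_on_def
    by (intro Ck_on_Pair U) (meson Ck_on_subset Int_lower1 Int_lower2 image_mono)+
  then have "smooth_on (chart M p ` (V \<inter> W))
      (chart (prod_manifold N K) (F p, G p) \<circ> (\<lambda>x. (F x, G x)) \<circ> chart_inv M p)"
    by (simp add: smooth_on_def prod_manifold_def comp_def)
  moreover have "(\<lambda>x. (F x, G x)) ` (V \<inter> W) \<subseteq> chart_dom (prod_manifold N K) (F p, G p)"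
    using V W by (auto simp: prod_manifold_def)
  moreover have "(F p, G p) \<in> pts (prod_manifold N K)"
    using q r by (simp add: pts_def prod_manifold_def)
  ultimately show ?thesis
    unfolding smooth_near_def using p o V W by (intro conjI exI[of _ "V \<inter> W"]) auto
qed

lemma smooth_near_const:
  assumes "charted_manifold M" "charted_manifold N" "p \<in> pts M" "q \<in> pts N"
  shows "smooth_near M N (\<lambda>_. q) p"
proof -
  interpret M: charted_manifold M by fact
  interpret N: charted_manifold N by fact
  have "smooth_on (chart M p ` chart_dom M p) (chart N q \<circ> (\<lambda>_. q) \<circ> chart_inv M p)"
    using M.image_open[OF assms(3)] by (auto simp: smooth_on_def comp_def intro: Ck_on_const)
  then show ?thesis
    unfolding smooth_near_def using assms(3,4) M.dom_open M.dom_self N.dom_self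
    by (intro conjI exI[of _ "chart_dom M p"]) auto
qed

lemma smooth_near_ident:
  assumes "charted_manifold M" "p \<in> pts M"
  shows "smooth_near M M (\<lambda>x. x) p"
proof -
  interpret M: charted_manifold M by fact
  have "Ck_on k (chart M p ` chart_dom M p) (chart M p \<circ> (\<lambda>x. x) \<circ> chart_inv M p)" for k
    by (rule Ck_on_cong[OF M.image_open[OF assms(2)] _ Ck_on_ident[OF M.image_open[OF assms(2)]]])
      (auto simp: M.chart_inv_chart[OF assms(2)])
  then show ?thesis
    unfolding smooth_near_def smooth_on_def using assms(2) M.dom_open M.dom_self
    by (intro conjI exI[of _ "chart_dom M p"]) auto
qed

section \<open>Smooth maps on subsets of manifolds\<close>

lemma local_extension_at: "local_extension M N S f p F \<Longrightarrow> p \<in> S \<Longrightarrow> F p = f p"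
  by (auto simp: local_extension_def)

text \<open>The source of closure facts such as \<open>comp_mem\<close> and \<open>act_mem\<close>:
  \<open>smooth_near\<close> includes membership of the image point, and an extension agrees with
  \<open>f\<close> at \<open>p\<close>.\<close>

lemma smooth_map_on_mem:
  assumes "smooth_map_on M N S f" "p \<in> S"
  shows "p \<in> pts M" "f p \<in> pts N"
proof -
  obtain F where F: "local_extension M N S f p F"
    using assms by (auto simp: smooth_map_on_def)
  then have "p \<in> pts M" "F p \<in> pts N"
    by (auto simp: local_extension_def smooth_near_def)
  then show "p \<in> pts M" "f p \<in> pts N"
    using local_extension_at[OF F assms(2)] by auto
qed

lemma smooth_map_on_subset:
  assumes "smooth_map_on M N S f" "T \<subseteq> S"
  shows "smooth_map_on M N T f"
proof -
  have "local_extension M N T f p F" if "local_extension M N S f p F" for p F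
    using that assms(2) unfolding local_extension_def by auto
  then show ?thesis
    using assms unfolding smooth_map_on_def by (metis subsetD)
qed

text \<open>Extensions are composed. The neighbourhood has to be so small that the extension of
  \<open>f\<close> maps it to where the extension of \<open>g\<close> is known to agree with
  \<open>g\<close> on \<open>T\<close>.\<close>

lemma smooth_map_on_compose:
  assumes M: "charted_manifold M" and N: "charted_manifold N"
    and f: "smooth_map_on M N S f" and g: "smooth_map_on N K T g" and ST: "f ` S \<subseteq> T"
  shows "smooth_map_on M K S (\<lambda>x. g (f x))"
  unfolding smooth_map_on_def
proof
  fix p assume p: "p \<in> S"
  then obtain F where F: "local_extension M N S f p F"
    using f by (auto simp: smooth_map_on_def)
  obtain G where G: "local_extension N K T g (F p) G"
    using g p ST local_extension_at[OF F p] by (auto simp: smooth_map_on_def)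
  obtain V' where V': "openin (mtop M) V'" "p \<in> V'" "\<forall>x\<in>S \<inter> V'. F x = f x"
    using F by (auto simp: local_extension_def)
  obtain V where V: "openin (mtop N) V" "F p \<in> V" "\<forall>x\<in>T \<inter> V. G x = g x"
    using G by (auto simp: local_extension_def)
  have sF: "smooth_near M N F p" and sG: "smooth_near N K G (F p)"
    using F G by (auto simp: local_extension_def)
  obtain W where W: "openin (mtop M) W" "p \<in> W" "W \<subseteq> V'" "F ` W \<subseteq> V"
    using smooth_near_shrink[OF M N sF V(1,2) V'(1,2)] by metis
  have "(G \<circ> F) x = g (f x)" if "x \<in> S \<inter> W" for x
  proof -
    have "F x = f x" using that W(3) V'(3) by blast
    moreover have "F x \<in> V" "f x \<in> T" using that W(4) ST by blast+
    ultimately show ?thesis using V(3) by simp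
  qed
  then show "\<exists>F. local_extension M K S (\<lambda>x. g (f x)) p F"
    unfolding local_extension_def using smooth_near_compose[OF M N sF sG] W by blast
qed

lemma smooth_map_on_Pair:
  assumes M: "charted_manifold M" and f: "smooth_map_on M N S f" and g: "smooth_map_on M K S g"
  shows "smooth_map_on M (prod_manifold N K) S (\<lambda>x. (f x, g x))"
  unfolding smooth_map_on_def
proof
  fix p assume p: "p \<in> S"
  obtain F where F: "local_extension M N S f p F"
    using f p by (auto simp: smooth_map_on_def)
  obtain G where G: "local_extension M K S g p G"
    using g p by (auto simp: smooth_map_on_def)
  obtain V where V: "openin (mtop M) V" "p \<in> V" "\<forall>x\<in>S \<inter> V. F x = f x"
    using F by (auto simp: local_extension_def)
  obtain W where W: "openin (mtop M) W" "p \<in> W" "\<forall>x\<in>S \<inter> W. G x = g x"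
    using G by (auto simp: local_extension_def)
  have "smooth_near M (prod_manifold N K) (\<lambda>x. (F x, G x)) p"
    using F G by (intro smooth_near_Pair M) (auto simp: local_extension_def)
  then have "local_extension M (prod_manifold N K) S (\<lambda>x. (f x, g x)) p (\<lambda>x. (F x, G x))"
    unfolding local_extension_def using V W by (intro conjI exI[of _ "V \<inter> W"]) auto
  then show "\<exists>F. local_extension M (prod_manifold N K) S (\<lambda>x. (f x, g x)) p F" by blast
qed

lemma smooth_near_imp_smooth_map_on:
  assumes "\<And>p. p \<in> S \<Longrightarrow> smooth_near M N f p"
  shows "smooth_map_on M N S f"
  unfolding smooth_map_on_def local_extension_def
proof
  fix p assume p: "p \<in> S"
  have "p \<in> topspace (mtop M)"
    using assms[OF p] by (simp add: smooth_near_def pts_def)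
  then show "\<exists>F. smooth_near M N F p \<and> (\<exists>W. openin (mtop M) W \<and> p \<in> W \<and> (\<forall>x\<in>S \<inter> W. F x = f x))"
    using assms[OF p] by (intro exI[of _ f] conjI exI[of _ "topspace (mtop M)"]) auto
qed

lemma smooth_map_on_const:
  assumes "charted_manifold M" "charted_manifold N" "S \<subseteq> pts M" "q \<in> pts N"
  shows "smooth_map_on M N S (\<lambda>_. q)"
  using assms by (intro smooth_near_imp_smooth_map_on smooth_near_const) auto

lemma smooth_map_on_ident:
  assumes "charted_manifold M" "S \<subseteq> pts M"
  shows "smooth_map_on M M S (\<lambda>x. x)"
  using assms by (intro smooth_near_imp_smooth_map_on smooth_near_ident) auto

section \<open>Velocities of curves\<close>

lemma smooth_near_has_derivative:
  assumes "charted_manifold M" and F: "smooth_near M N F p"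
  shows "((chart N (F p) \<circ> F \<circ> chart_inv M p) has_derivative differential M N F p) (at (chart M p p))"
proof -
  interpret M: charted_manifold M by fact
  have p: "p \<in> pts M"
    using F by (auto simp: smooth_near_def)
  obtain W where W: "openin (mtop M) W" "p \<in> W" "W \<subseteq> chart_dom M p"
    and sm: "smooth_on (chart M p ` W) (chart N (F p) \<circ> F \<circ> chart_inv M p)"
    using F by (auto simp: smooth_near_def)
  have "open (chart M p ` W)"
    using M.openin_iff_chart[OF p] W by blast
  moreover have "Ck_on (Suc 0) (chart M p ` W) (chart N (F p) \<circ> F \<circ> chart_inv M p)"
    using sm unfolding smooth_on_def by blast
  ultimately show ?thesis
    unfolding differential_def using W(2) by (intro Ck_on_Suc_has_derivative[where k = 0]) auto
qed

text \<open>The chart with index \<open>\<gamma> 0\<close> is the one whose coordinates represent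
  tangent vectors at that point. Chart values outside its domain mean nothing, hence the demand that
  the curve stay in the domain near 0. Differentiability is asked for at 0 only, which is what
  \<open>level_set_curve\<close> delivers.\<close>

definition has_velocity ::
    "('a, 'e::real_normed_vector) manifold \<Rightarrow> (real \<Rightarrow> 'a) \<Rightarrow> 'e \<Rightarrow> bool" where
  "has_velocity M \<gamma> v \<longleftrightarrow> \<gamma> 0 \<in> pts M \<and> (\<forall>\<^sub>F t in nhds 0. \<gamma> t \<in> chart_dom M (\<gamma> 0)) \<and>
     ((\<lambda>t. chart M (\<gamma> 0) (\<gamma> t)) has_vector_derivative v) (at 0)"

lemma has_vector_derivative_cong_nhds:
  assumes "(f has_vector_derivative v) (at x)" "\<forall>\<^sub>F t in nhds x. f t = g t"
  shows "(g has_vector_derivative v) (at x)"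
proof -
  obtain S where S: "open S" "x \<in> S" "\<And>t. t \<in> S \<Longrightarrow> f t = g t"
    using assms(2) unfolding eventually_nhds by blast
  then show ?thesis
    using assms(1) has_vector_derivative_transform_within_open by blast
qed

lemma has_velocity_cong:
  assumes \<gamma>: "has_velocity M \<gamma> v" and eq: "\<forall>\<^sub>F t in nhds 0. \<gamma> t = \<eta> t"
  shows "has_velocity M \<eta> v"
proof -
  have 0: "\<gamma> 0 = \<eta> 0"
    using eq by (rule eventually_nhds_x_imp_x)
  have "\<forall>\<^sub>F t in nhds 0. \<eta> t \<in> chart_dom M (\<eta> 0)"
    using \<gamma> eq unfolding has_velocity_def 0 by (auto elim: eventually_elim2)
  moreover have "((\<lambda>t. chart M (\<eta> 0) (\<eta> t)) has_vector_derivative v) (at 0)"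
    by (rule has_vector_derivative_cong_nhds[of "\<lambda>t. chart M (\<eta> 0) (\<gamma> t)"])
      (use \<gamma> eq in \<open>auto simp: has_velocity_def 0 elim: eventually_mono\<close>)
  ultimately show ?thesis
    using \<gamma> by (simp add: has_velocity_def 0)
qed

text \<open>The geometric identities below are obtained by computing the velocity of one curve in
  two ways.\<close>

lemma has_velocity_unique: "has_velocity M \<gamma> v \<Longrightarrow> has_velocity M \<gamma> w \<Longrightarrow> v = w"
  unfolding has_velocity_def by (meson vector_derivative_unique_at)

lemma has_velocity_const: "charted_manifold M \<Longrightarrow> p \<in> pts M \<Longrightarrow> has_velocity M (\<lambda>_. p) 0"
  by (simp add: has_velocity_def charted_manifold.dom_self)

lemma has_velocity_Pair:
  assumes "has_velocity M \<gamma> v" "has_velocity N \<eta> w"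
  shows "has_velocity (prod_manifold M N) (\<lambda>t. (\<gamma> t, \<eta> t)) (v, w)"
  using assms unfolding has_velocity_def
  by (auto simp: prod_manifold_def pts_def intro: eventually_conj has_vector_derivative_Pair)

text \<open>Continuity at 0 in the topology of the manifold, pulled back from the chart by
  injectivity of the chart on its domain.\<close>

lemma has_velocity_eventually:
  assumes "charted_manifold M" and \<gamma>: "has_velocity M \<gamma> v" and W: "openin (mtop M) W" "\<gamma> 0 \<in> W"
  shows "\<forall>\<^sub>F t in nhds 0. \<gamma> t \<in> W"
proof -
  interpret M: charted_manifold M by fact
  let ?p = "\<gamma> 0"
  have p: "?p \<in> pts M"
    using \<gamma> by (simp add: has_velocity_def)
  define V where "V = W \<inter> chart_dom M ?p"
  have "open (chart M ?p ` V)"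
    unfolding V_def using W M.dom_open[OF p] by (subst M.openin_iff_chart[OF p, symmetric]) auto
  moreover have "((\<lambda>t. chart M ?p (\<gamma> t)) \<longlongrightarrow> chart M ?p ?p) (nhds 0)"
  proof -
    have "isCont (\<lambda>t. chart M ?p (\<gamma> t)) 0"
      using \<gamma> has_vector_derivative_continuous unfolding has_velocity_def by blast
    then show ?thesis
      by (simp add: isCont_def tendsto_nhds_iff)
  qed
  moreover have "chart M ?p ?p \<in> chart M ?p ` V"
    using W(2) M.dom_self[OF p] by (auto simp: V_def)
  ultimately have "\<forall>\<^sub>F t in nhds 0. chart M ?p (\<gamma> t) \<in> chart M ?p ` V"
    using topological_tendstoD by fast
  moreover have "\<forall>\<^sub>F t in nhds 0. \<gamma> t \<in> chart_dom M ?p"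
    using \<gamma> by (simp add: has_velocity_def)
  ultimately show ?thesis
    by eventually_elim (use inj_onD[OF M.chart_inj[OF p]] in \<open>auto simp: V_def\<close>)
qed

lemma has_velocity_smooth_near:
  assumes M: "charted_manifold M" and \<gamma>: "has_velocity M \<gamma> v" and F: "smooth_near M N F (\<gamma> 0)"
  shows "has_velocity N (\<lambda>t. F (\<gamma> t)) (differential M N F (\<gamma> 0) v)"
proof -
  interpret M: charted_manifold M by fact
  let ?p = "\<gamma> 0"
  have p: "?p \<in> pts M" and q: "F ?p \<in> pts N"
    using F by (auto simp: smooth_near_def)
  obtain W where W: "openin (mtop M) W" "?p \<in> W" "W \<subseteq> chart_dom M ?p" "F ` W \<subseteq> chart_dom N (F ?p)"
    using F by (auto simp: smooth_near_def)
  have ev: "\<forall>\<^sub>F t in nhds 0. \<gamma> t \<in> W"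
    by (rule has_velocity_eventually[OF M \<gamma> W(1,2)])
  have c: "((\<lambda>t. chart M ?p (\<gamma> t)) has_derivative (\<lambda>t. t *\<^sub>R v)) (at 0)"
    using \<gamma> by (simp add: has_velocity_def has_vector_derivative_def)
  note F' = smooth_near_has_derivative[OF M F]
  have "linear (differential M N F ?p)"
    using F' by (rule has_derivative_linear)
  then have "((chart N (F ?p) \<circ> F \<circ> chart_inv M ?p) \<circ> (\<lambda>t. chart M ?p (\<gamma> t))
      has_vector_derivative differential M N F ?p v) (at 0)"
    using diff_chain_at[OF c F'] by (simp add: has_vector_derivative_def comp_def linear_scale)
  moreover have "\<forall>\<^sub>F t in nhds 0. ((chart N (F ?p) \<circ> F \<circ> chart_inv M ?p) \<circ> (\<lambda>t. chart M ?p (\<gamma> t))) t =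
      chart N (F ?p) (F (\<gamma> t))"
    using ev by eventually_elim (use W(3) M.chart_inv_chart[OF p] in auto)
  ultimately have "((\<lambda>t. chart N (F ?p) (F (\<gamma> t))) has_vector_derivative differential M N F ?p v) (at 0)"
    by (rule has_vector_derivative_cong_nhds)
  moreover have "\<forall>\<^sub>F t in nhds 0. F (\<gamma> t) \<in> chart_dom N (F ?p)"
    using ev by eventually_elim (use W(4) in auto)
  ultimately show ?thesis
    using q by (simp add: has_velocity_def)
qed

text \<open>The chosen extension is unknown, but it agrees with \<open>f\<close> along a curve that
  stays in \<open>S\<close>, so the image curve determines the value of the differential on the
  velocity.\<close>

lemma has_velocity_on:
  assumes M: "charted_manifold M" and f: "smooth_map_on M N S f"
    and \<gamma>: "has_velocity M \<gamma> v" and S: "\<forall>\<^sub>F t in nhds 0. \<gamma> t \<in> S"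
  shows "has_velocity N (\<lambda>t. f (\<gamma> t)) (differential_on M N S f (\<gamma> 0) v)"
proof -
  have 0: "\<gamma> 0 \<in> S"
    using S by (rule eventually_nhds_x_imp_x)
  define F where "F = (SOME F. local_extension M N S f (\<gamma> 0) F)"
  have "\<exists>F. local_extension M N S f (\<gamma> 0) F"
    using f 0 unfolding smooth_map_on_def by (rule bspec)
  then have F: "local_extension M N S f (\<gamma> 0) F"
    unfolding F_def by (rule someI_ex)
  then obtain W where W: "openin (mtop M) W" "\<gamma> 0 \<in> W" "\<forall>x\<in>S \<inter> W. F x = f x"
    by (auto simp: local_extension_def)
  have "has_velocity N (\<lambda>t. F (\<gamma> t)) (differential M N F (\<gamma> 0) v)"
    using F by (intro has_velocity_smooth_near[OF M \<gamma>]) (simp add: local_extension_def)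
  moreover have "\<forall>\<^sub>F t in nhds 0. F (\<gamma> t) = f (\<gamma> t)"
    using S has_velocity_eventually[OF M \<gamma> W(1,2)] by eventually_elim (use W(3) in auto)
  ultimately have "has_velocity N (\<lambda>t. f (\<gamma> t)) (differential M N F (\<gamma> 0) v)"
    by (rule has_velocity_cong)
  then show ?thesis
    by (simp add: differential_on_def F_def)
qed

text \<open>The value is the differential of one fixed smooth extension, hence linear on the whole
  model space and not merely on vectors tangent to \<open>S\<close>.\<close>

lemma differential_on_linear:
  assumes M: "charted_manifold M" and f: "smooth_map_on M N S f" and p: "p \<in> S"
  shows "linear (differential_on M N S f p)"
proof -
  define F where "F = (SOME F. local_extension M N S f p F)"
  have "\<exists>F. local_extension M N S f p F"
    using f p unfolding smooth_map_on_def by (rule bspec)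
  then have "local_extension M N S f p F"
    unfolding F_def by (rule someI_ex)
  then have "linear (differential M N F p)"
    unfolding local_extension_def
    by (metis has_derivative_linear smooth_near_has_derivative[OF M])
  then show ?thesis
    by (simp add: differential_on_def F_def)
qed

text \<open>Smoothness on all of \<open>pts M\<close> also provides extensions only. They agree with
  \<open>f\<close> on a full neighbourhood, so that the derivatives in the chart coincide.\<close>

lemma differential_local_extension:
  assumes "charted_manifold M" and F: "local_extension M N (pts M) f p F"
  shows "differential M N f p = differential M N F p"
proof -
  interpret M: charted_manifold M by fact
  obtain W where W: "openin (mtop M) W" "p \<in> W" "\<forall>x\<in>pts M \<inter> W. F x = f x"
    and sm: "smooth_near M N F p"
    using F by (auto simp: local_extension_def)
  have p: "p \<in> pts M"
    using sm by (simp add: smooth_near_def)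
  have Fp: "F p = f p"
    using W p by auto
  let ?V = "W \<inter> chart_dom M p"
  have V: "open (chart M p ` ?V)" "chart M p p \<in> chart M p ` ?V"
    using W M.dom_open[OF p] M.dom_self[OF p] by (auto simp flip: M.openin_iff_chart[OF p])
  have "frechet_derivative (chart N (F p) \<circ> F \<circ> chart_inv M p) (at (chart M p p)) =
      frechet_derivative (chart N (F p) \<circ> f \<circ> chart_inv M p) (at (chart M p p))"
  proof (rule frechet_derivative_transform_within_open[OF _ V])
    show "(chart N (F p) \<circ> F \<circ> chart_inv M p) differentiable at (chart M p p)"
      using smooth_near_has_derivative[OF assms(1) sm] by (auto simp: differentiable_def)
  qed (use W(3) M.chart_inv_chart[OF p] M.dom_subset[OF p] in auto)
  then show ?thesis
    by (simp add: differential_def Fp)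
qed

lemma differential_linear:
  assumes M: "charted_manifold M" and f: "smooth_map_on M N (pts M) f" and p: "p \<in> pts M"
  shows "linear (differential M N f p)"
proof -
  obtain F where F: "local_extension M N (pts M) f p F"
    using f p by (auto simp: smooth_map_on_def)
  then have "linear (differential M N F p)"
    unfolding local_extension_def
    by (metis has_derivative_linear smooth_near_has_derivative[OF M])
  then show ?thesis
    by (simp add: differential_local_extension[OF M F])
qed

lemma has_velocity_smooth:
  assumes M: "charted_manifold M" and f: "smooth_map_on M N (pts M) f" and \<gamma>: "has_velocity M \<gamma> v"
  shows "has_velocity N (\<lambda>t. f (\<gamma> t)) (differential M N f (\<gamma> 0) v)"
proof -
  have p: "\<gamma> 0 \<in> pts M"
    using \<gamma> by (simp add: has_velocity_def)
  then obtain F where F: "local_extension M N (pts M) f (\<gamma> 0) F"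
    using f by (auto simp: smooth_map_on_def)
  then obtain W where W: "openin (mtop M) W" "\<gamma> 0 \<in> W" "\<forall>x\<in>pts M \<inter> W. F x = f x"
    by (auto simp: local_extension_def)
  have "has_velocity N (\<lambda>t. F (\<gamma> t)) (differential M N F (\<gamma> 0) v)"
    using F by (intro has_velocity_smooth_near[OF M \<gamma>]) (simp add: local_extension_def)
  moreover have "\<forall>\<^sub>F t in nhds 0. F (\<gamma> t) = f (\<gamma> t)"
    using has_velocity_eventually[OF M \<gamma> W(1,2)]
    by eventually_elim (use W(3) openin_subset[OF W(1)] in \<open>auto simp: pts_def\<close>)
  ultimately have "has_velocity N (\<lambda>t. f (\<gamma> t)) (differential M N F (\<gamma> 0) v)"
    by (rule has_velocity_cong)
  then show ?thesis
    by (simp add: differential_local_extension[OF M F])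
qed

text \<open>Transports \<open>level_set_curve\<close> through the charts at \<open>p\<close> and its
  image, for an extension of \<open>f\<close> restricted to where it equals
  \<open>f\<close>.\<close>

lemma fibre_curve:
  fixes M :: "('a, 'e::real_normed_vector) manifold" and N :: "('b, 'f::real_normed_vector) manifold"
  assumes M: "charted_manifold M" and N: "charted_manifold N" and f: "smooth_map_on M N (pts M) f"
    and p: "p \<in> pts M" and surj: "surj (differential M N f p)" and v: "differential M N f p v = 0"
  obtains \<gamma> where "\<gamma> 0 = p" "has_velocity M \<gamma> v" "\<forall>\<^sub>F t in nhds 0. \<gamma> t \<in> pts M \<and> f (\<gamma> t) = f p"
proof -
  interpret M: charted_manifold M by fact
  interpret N: charted_manifold N by fact
  obtain F where F: "local_extension M N (pts M) f p F"
    using f p by (auto simp: smooth_map_on_def)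
  then obtain W' where W': "openin (mtop M) W'" "p \<in> W'" "\<forall>x\<in>pts M \<inter> W'. F x = f x"
    and sm: "smooth_near M N F p"
    by (auto simp: local_extension_def)
  have q: "F p \<in> pts N"
    using sm by (simp add: smooth_near_def)
  obtain W where W: "p \<in> W" "W \<subseteq> chart_dom M p" "W \<subseteq> W'" "F ` W \<subseteq> chart_dom N (F p)" "open (chart M p ` W)"
    and smW: "smooth_on (chart M p ` W) (chart N (F p) \<circ> F \<circ> chart_inv M p)"
    using smooth_near_shrink[OF M N sm N.dom_open[OF q] N.dom_self[OF q] W'(1,2)] by metis
  define \<phi> where "\<phi> = chart N (F p) \<circ> F \<circ> chart_inv M p"
  have D: "frechet_derivative \<phi> (at (chart M p p)) = differential M N f p"
    unfolding differential_local_extension[OF M F] by (simp add: differential_def \<phi>_def)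
  have C1: "Ck_on (Suc 0) (chart M p ` W) \<phi>"
    using smW unfolding smooth_on_def \<phi>_def by blast
  obtain B and \<beta> :: "'e \<Rightarrow> 'e \<Rightarrow> real" where \<beta>: "finite_coords B \<beta>"
    using finite_coords_exist[OF M.model_finite_dim] by blast
  obtain C and \<delta> :: "'f \<Rightarrow> 'f \<Rightarrow> real" where \<delta>: "finite_coords C \<delta>"
    using finite_coords_exist[OF N.model_finite_dim] by blast
  obtain w where w0: "w 0 = chart M p p"
    and w: "\<forall>\<^sub>F t in nhds (0::real). w t \<in> chart M p ` W \<and> \<phi> (w t) = \<phi> (chart M p p)"
    and w': "(w has_vector_derivative v) (at 0)"
    using level_set_curve[OF \<beta> \<delta> W(5) C1 imageI[OF W(1)]] surj v unfolding D by metis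
  define \<gamma> where "\<gamma> = chart_inv M p \<circ> w"
  have \<gamma>0: "\<gamma> 0 = p"
    using M.chart_inv_chart[OF p M.dom_self[OF p]] by (simp add: \<gamma>_def w0)
  have \<gamma>W: "\<gamma> t \<in> W" "chart M p (\<gamma> t) = w t" if "w t \<in> chart M p ` W" for t
    using that W(2) M.chart_inv_chart[OF p] by (auto simp: \<gamma>_def)
  have ev: "\<forall>\<^sub>F t in nhds 0. \<gamma> t \<in> W"
    using w by eventually_elim (use \<gamma>W in auto)
  have "((\<lambda>t. chart M p (\<gamma> t)) has_vector_derivative v) (at 0)"
    by (rule has_vector_derivative_cong_nhds[OF w']) (use w in eventually_elim, use \<gamma>W in auto)
  moreover have "\<forall>\<^sub>F t in nhds 0. \<gamma> t \<in> chart_dom M p"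
    using ev by eventually_elim (use W(2) in auto)
  ultimately have vel: "has_velocity M \<gamma> v"
    using p by (simp add: has_velocity_def \<gamma>0)
  have fib: "\<forall>\<^sub>F t in nhds 0. \<gamma> t \<in> pts M \<and> f (\<gamma> t) = f p"
    using w
  proof eventually_elim
    fix t assume t: "w t \<in> chart M p ` W \<and> \<phi> (w t) = \<phi> (chart M p p)"
    then have W': "\<gamma> t \<in> W" and "chart_inv M p (w t) = \<gamma> t"
      using \<gamma>W by (auto simp: \<gamma>_def)
    then have "chart N (F p) (F (\<gamma> t)) = chart N (F p) (F p)"
      using t M.chart_inv_chart[OF p M.dom_self[OF p]] by (simp add: \<phi>_def)
    \<comment> \<open>Equal coordinates give equal points, since \<open>F\<close> maps
      \<open>W\<close> into the chart domain.\<close>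
    then have "F (\<gamma> t) = F p"
      using W(1,4) W' inj_onD[OF N.chart_inj[OF q]] by blast
    moreover have "\<gamma> t \<in> pts M"
      using W' W(2) M.dom_subset[OF p] by blast
    ultimately show "\<gamma> t \<in> pts M \<and> f (\<gamma> t) = f p"
      using \<open>\<forall>x\<in>pts M \<inter> W'. F x = f x\<close> W' W(1,3) p by (metis IntI subsetD)
  qed
  show thesis
    using that[OF \<gamma>0 vel fib] .
qed

section \<open>Lie groupoids and principal bundles\<close>

context lie_groupoid
begin

lemma charted_Obj: "charted_manifold (Obj X)"
  using Obj_manifold by (rule smooth_manifold.charted)

lemma charted_Arr: "charted_manifold (Arr X)"
  using Arr_manifold by (rule smooth_manifold.charted)

lemma src_smooth: "smooth_map_on (Arr X) (Obj X) (pts (Arr X)) (src X)"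
  using src_submersion by (simp add: submersion_def)

lemma tgt_smooth: "smooth_map_on (Arr X) (Obj X) (pts (Arr X)) (tgt X)"
  using tgt_submersion by (simp add: submersion_def)

lemmas src_mem [simp] = smooth_map_on_mem(2)[OF src_smooth]
lemmas tgt_mem [simp] = smooth_map_on_mem(2)[OF tgt_smooth]
lemmas unit_mem [simp] = smooth_map_on_mem(2)[OF unit_smooth]
lemmas ginv_mem [simp] = smooth_map_on_mem(2)[OF ginv_smooth]

lemma comp_mem [simp]:
  "g \<in> pts (Arr X) \<Longrightarrow> h \<in> pts (Arr X) \<Longrightarrow> src X g = tgt X h \<Longrightarrow> gcomp X g h \<in> pts (Arr X)"
  using smooth_map_on_mem(2)[OF comp_smooth, of "(g, h)"] by (simp add: fibre_prod_def)

lemmas groupoid_simps [simp] = src_comp tgt_comp src_unit tgt_unit src_ginv tgt_ginv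

lemma comp_unit_right' [simp]:
  "g \<in> pts (Arr X) \<Longrightarrow> src X g = x \<Longrightarrow> gcomp X g (unit_at X x) = g"
  using comp_unit_right by blast

lemma comp_unit_left' [simp]:
  "g \<in> pts (Arr X) \<Longrightarrow> tgt X g = x \<Longrightarrow> gcomp X (unit_at X x) g = g"
  using comp_unit_left by blast

lemma comp_ginv_cancel_right:
  "g \<in> pts (Arr X) \<Longrightarrow> h \<in> pts (Arr X) \<Longrightarrow> src X h = tgt X g \<Longrightarrow>
    gcomp X (gcomp X h g) (ginv X g) = h"
  by (simp add: comp_assoc comp_ginv_right)

lemma comp_ginv_cancel_right':
  "g \<in> pts (Arr X) \<Longrightarrow> h \<in> pts (Arr X) \<Longrightarrow> src X h = src X g \<Longrightarrow>
    gcomp X (gcomp X h (ginv X g)) g = h"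
  by (simp add: comp_assoc comp_ginv_left)

text \<open>A left inverse is the inverse; the rules for inverses of units, inverses and products
  follow by exhibiting one.\<close>

lemma ginv_unique:
  assumes "g \<in> pts (Arr X)" "k \<in> pts (Arr X)" "src X k = tgt X g" "gcomp X k g = unit_at X (src X g)"
  shows "k = ginv X g"
  using comp_ginv_cancel_right[OF assms(1-3)] assms by simp

lemma ginv_unit [simp]: "x \<in> pts (Obj X) \<Longrightarrow> ginv X (unit_at X x) = unit_at X x"
  by (rule ginv_unique[symmetric]) auto

lemma ginv_ginv [simp]: "g \<in> pts (Arr X) \<Longrightarrow> ginv X (ginv X g) = g"
  by (rule ginv_unique[symmetric]) (auto simp: comp_ginv_right)

lemma ginv_comp:
  assumes "g \<in> pts (Arr X)" "h \<in> pts (Arr X)" "src X g = tgt X h"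
  shows "ginv X (gcomp X g h) = gcomp X (ginv X h) (ginv X g)"
proof (rule ginv_unique[symmetric])
  have "gcomp X (gcomp X (ginv X h) (ginv X g)) (gcomp X g h) =
      gcomp X (ginv X h) (gcomp X (gcomp X (ginv X g) g) h)"
    using assms by (simp add: comp_assoc)
  also have "\<dots> = unit_at X (src X h)"
    using assms by (simp add: comp_ginv_left)
  finally show "gcomp X (gcomp X (ginv X h) (ginv X g)) (gcomp X g h) = unit_at X (src X (gcomp X g h))"
    using assms by simp
qed (use assms in auto)

lemma src_fibre_iff [simp]: "h \<in> src_fibre X x \<longleftrightarrow> h \<in> pts (Arr X) \<and> src X h = x"
  by (simp add: src_fibre_def)

lemma src_fibre_subset: "src_fibre X x \<subseteq> pts (Arr X)"
  by auto

section \<open>Translations along source fibres\<close>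

lemma right_mult_smooth:
  assumes "g \<in> pts (Arr X)"
  shows "smooth_map_on (Arr X) (Arr X) (src_fibre X (tgt X g)) (\<lambda>h. gcomp X h g)"
proof -
  have "smooth_map_on (Arr X) (prod_manifold (Arr X) (Arr X)) (src_fibre X (tgt X g)) (\<lambda>h. (h, g))"
    using assms by (intro smooth_map_on_Pair smooth_map_on_ident smooth_map_on_const charted_Arr src_fibre_subset)
  from smooth_map_on_compose[OF charted_Arr charted_prod[OF charted_Arr charted_Arr] this comp_smooth]
  show ?thesis
    using assms by (simp add: fibre_prod_def image_subset_iff)
qed

lemma left_mult_ginv_smooth:
  assumes "g \<in> pts (Arr X)"
  shows "smooth_map_on (Arr X) (Arr X) (src_fibre X (src X g)) (\<lambda>h. gcomp X g (ginv X h))"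
proof -
  have "smooth_map_on (Arr X) (prod_manifold (Arr X) (Arr X)) (src_fibre X (src X g)) (\<lambda>h. (g, ginv X h))"
    using assms smooth_map_on_subset[OF ginv_smooth src_fibre_subset]
    by (intro smooth_map_on_Pair smooth_map_on_const charted_Arr src_fibre_subset)
  from smooth_map_on_compose[OF charted_Arr charted_prod[OF charted_Arr charted_Arr] this comp_smooth]
  show ?thesis
    using assms by (simp add: fibre_prod_def image_subset_iff)
qed

lemma src_fibre_curve:
  assumes "g \<in> pts (Arr X)" "differential (Arr X) (Obj X) (src X) g v = 0"
  obtains \<gamma> where "\<gamma> 0 = g" "has_velocity (Arr X) \<gamma> v" "\<forall>\<^sub>F t in nhds 0. \<gamma> t \<in> src_fibre X (src X g)"
proof -
  have "surj (differential (Arr X) (Obj X) (src X) g)"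
    using src_submersion assms(1) by (simp add: submersion_def)
  from fibre_curve[OF charted_Arr charted_Obj src_smooth assms(1) this assms(2)] that
  show thesis by auto
qed

lemma algd_curve:
  assumes "x \<in> pts (Obj X)" "\<alpha> \<in> algd X x"
  obtains \<gamma> where "\<gamma> 0 = unit_at X x" "has_velocity (Arr X) \<gamma> \<alpha>" "\<forall>\<^sub>F t in nhds 0. \<gamma> t \<in> src_fibre X x"
proof -
  have "differential (Arr X) (Obj X) (src X) (unit_at X x) \<alpha> = 0"
    using assms(2) by (simp add: algd_def)
  from src_fibre_curve[OF unit_mem[OF assms(1)] this] that assms(1)
  show thesis by auto
qed

text \<open>Converse to \<open>src_fibre_curve\<close>: the source is constant along the curve, and
  a constant curve has velocity 0.\<close>

lemma src_fibre_velocity: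
  assumes \<gamma>: "has_velocity (Arr X) \<gamma> v" and fib: "\<forall>\<^sub>F t in nhds 0. \<gamma> t \<in> src_fibre X x"
  shows "differential (Arr X) (Obj X) (src X) (\<gamma> 0) v = 0"
proof -
  have "\<gamma> 0 \<in> src_fibre X x"
    using fib by (rule eventually_nhds_x_imp_x)
  then have "has_velocity (Obj X) (\<lambda>_. x) 0"
    by (intro has_velocity_const charted_Obj) auto
  moreover have "has_velocity (Obj X) (\<lambda>_. x) (differential (Arr X) (Obj X) (src X) (\<gamma> 0) v)"
    by (rule has_velocity_cong[OF has_velocity_smooth[OF charted_Arr src_smooth \<gamma>]])
      (use fib in eventually_elim, simp)
  ultimately show ?thesis
    using has_velocity_unique by blast
qed

lemma right_transl_velocity:
  assumes "g \<in> pts (Arr X)" and "\<gamma> 0 = unit_at X (tgt X g)" and "has_velocity (Arr X) \<gamma> \<alpha>"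
    and "\<forall>\<^sub>F t in nhds 0. \<gamma> t \<in> src_fibre X (tgt X g)"
  shows "has_velocity (Arr X) (\<lambda>t. gcomp X (\<gamma> t) g) (right_transl X g \<alpha>)"
  using has_velocity_on[OF charted_Arr right_mult_smooth[OF assms(1)] assms(3,4)] assms(2)
  by (simp add: right_transl_def)

lemma left_transl_velocity:
  assumes "g \<in> pts (Arr X)" and "\<gamma> 0 = unit_at X (src X g)" and "has_velocity (Arr X) \<gamma> \<alpha>"
    and "\<forall>\<^sub>F t in nhds 0. \<gamma> t \<in> src_fibre X (src X g)"
  shows "has_velocity (Arr X) (\<lambda>t. gcomp X g (ginv X (\<gamma> t))) (left_transl X g \<alpha>)"
  using has_velocity_on[OF charted_Arr left_mult_ginv_smooth[OF assms(1)] assms(3,4)] assms(2)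
  by (simp add: left_transl_def)

text \<open>Right translation is a bijection from the algebroid at the target onto the kernel of ds
  at \<open>g\<close>; its inverse is the differential of right multiplication by the inverse of
  \<open>g\<close>. Both composites are checked on curves in source fibres. This gives the
  description in \<open>conn_form\<close> its meaning.\<close>

lemma right_transl_ex1:
  assumes g: "g \<in> pts (Arr X)" and w: "differential (Arr X) (Obj X) (src X) g w = 0"
  shows "\<exists>!\<alpha>. \<alpha> \<in> algd X (tgt X g) \<and> right_transl X g \<alpha> = w"
proof -
  define r where "r = (\<lambda>k. gcomp X k (ginv X g))"
  define \<beta> where "\<beta> = differential_on (Arr X) (Arr X) (src_fibre X (src X g)) r g w"
  have r: "smooth_map_on (Arr X) (Arr X) (src_fibre X (src X g)) r"
    using right_mult_smooth[of "ginv X g"] g by (simp add: r_def)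
  show ?thesis
  proof (rule ex1I[of _ \<beta>])
    obtain \<gamma> where \<gamma>: "\<gamma> 0 = g" "has_velocity (Arr X) \<gamma> w"
      and fib: "\<forall>\<^sub>F t in nhds 0. \<gamma> t \<in> src_fibre X (src X g)"
      using src_fibre_curve[OF g w] .
    have vel: "has_velocity (Arr X) (\<lambda>t. r (\<gamma> t)) \<beta>"
      using has_velocity_on[OF charted_Arr r \<gamma>(2) fib] by (simp add: \<beta>_def \<gamma>(1))
    have 0: "r (\<gamma> 0) = unit_at X (tgt X g)"
      using g by (simp add: r_def \<gamma>(1) comp_ginv_right)
    have fib': "\<forall>\<^sub>F t in nhds 0. r (\<gamma> t) \<in> src_fibre X (tgt X g)"
      using fib by eventually_elim (use g in \<open>simp add: r_def\<close>)
    have "\<beta> \<in> algd X (tgt X g)"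
      using src_fibre_velocity[OF vel fib'] by (simp add: algd_def 0)
    moreover have "has_velocity (Arr X) \<gamma> (right_transl X g \<beta>)"
    proof (rule has_velocity_cong[OF right_transl_velocity[OF g 0 vel fib']])
      show "\<forall>\<^sub>F t in nhds 0. gcomp X (r (\<gamma> t)) g = \<gamma> t"
        using fib by eventually_elim (use g in \<open>simp add: r_def comp_ginv_cancel_right'\<close>)
    qed
    ultimately show "\<beta> \<in> algd X (tgt X g) \<and> right_transl X g \<beta> = w"
      using has_velocity_unique[OF \<gamma>(2)] by simp
  next
    fix \<alpha> assume \<alpha>: "\<alpha> \<in> algd X (tgt X g) \<and> right_transl X g \<alpha> = w"
    then obtain \<gamma> where \<gamma>: "\<gamma> 0 = unit_at X (tgt X g)" "has_velocity (Arr X) \<gamma> \<alpha>"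
      and fib: "\<forall>\<^sub>F t in nhds 0. \<gamma> t \<in> src_fibre X (tgt X g)"
      using algd_curve[OF tgt_mem[OF g]] by blast
    have vel: "has_velocity (Arr X) (\<lambda>t. gcomp X (\<gamma> t) g) w"
      using right_transl_velocity[OF g \<gamma> fib] \<alpha> by simp
    have "\<forall>\<^sub>F t in nhds 0. gcomp X (\<gamma> t) g \<in> src_fibre X (src X g)"
      using fib by eventually_elim (use g in simp)
    from has_velocity_on[OF charted_Arr r vel this]
    have "has_velocity (Arr X) (\<lambda>t. r (gcomp X (\<gamma> t) g)) \<beta>"
      using g by (simp add: \<beta>_def \<gamma>(1))
    then have "has_velocity (Arr X) \<gamma> \<beta>"
      by (rule has_velocity_cong)
        (use fib in eventually_elim, use g in \<open>simp add: r_def comp_ginv_cancel_right\<close>)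
    then show "\<alpha> = \<beta>"
      using has_velocity_unique[OF \<gamma>(2)] by blast
  qed
qed

end

section \<open>Horizontal lifts and the connection form\<close>

locale groupoid_connection = lie_groupoid X + ehresmann_connection X H
  for X :: "('x, 'e0::real_normed_vector, 'g, 'e1::real_normed_vector) groupoid" and H
begin

lemma horizontal_subspace:
  assumes "g \<in> pts (Arr X)"
  shows "subspace (H g)"
proof -
  obtain W and n :: nat and V where "g \<in> W" "\<forall>q\<in>W. span ((\<lambda>i. V i q) ` {..<n}) = H q"
    using subbundle assms unfolding smooth_subbundle_def by metis
  then show ?thesis
    by (metis subspace_span)
qed

text \<open>Removing the part in the kernel of ds from a preimage of \<open>w\<close> gives
  existence. Two lifts differ by a vector that is both horizontal and in the kernel, hence
  zero.\<close>

lemma hor_lift: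
  assumes g: "g \<in> pts (Arr X)"
  shows "hor_lift X H g w \<in> H g" "differential (Arr X) (Obj X) (src X) g (hor_lift X H g w) = w"
proof -
  let ?D = "differential (Arr X) (Obj X) (src X) g"
  have lin: "linear ?D"
    by (rule differential_linear[OF charted_Arr src_smooth g])
  have "\<exists>!v. v \<in> H g \<and> ?D v = w"
  proof (rule ex_ex1I)
    obtain v where v: "?D v = w"
      using src_submersion g unfolding submersion_def by (metis surjD)
    have "v \<in> {u + v | u v. u \<in> H g \<and> ?D v = 0}"
      using complement_sum[OF g] by blast
    then obtain u k where "v = u + k" "u \<in> H g" "?D k = 0"
      by blast
    then show "\<exists>v. v \<in> H g \<and> ?D v = w"
      using v linear_add[OF lin] by auto
  next
    fix u v assume u: "u \<in> H g \<and> ?D u = w" and v: "v \<in> H g \<and> ?D v = w"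
    then have "u - v \<in> H g \<inter> {v. ?D v = 0}"
      using subspace_diff[OF horizontal_subspace[OF g]] linear_diff[OF lin] by simp
    then show "u = v"
      using complement_Int[OF g] by simp
  qed
  from theI'[OF this] show "hor_lift X H g w \<in> H g" "?D (hor_lift X H g w) = w"
    unfolding hor_lift_def by blast+
qed

text \<open>Subtracting the horizontal lift of its source component moves \<open>v\<close> into the
  kernel of ds, where \<open>right_transl_ex1\<close> applies.\<close>

lemma conn_form:
  assumes g: "g \<in> pts (Arr X)"
  shows "conn_form X H g v \<in> algd X (tgt X g)"
    and "right_transl X g (conn_form X H g v) =
      v - hor_lift X H g (differential (Arr X) (Obj X) (src X) g v)"
proof -
  let ?D = "differential (Arr X) (Obj X) (src X) g"
  have "?D (v - hor_lift X H g (?D v)) = 0"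
    using hor_lift(2)[OF g] by (simp add: linear_diff[OF differential_linear[OF charted_Arr src_smooth g]])
  from theI'[OF right_transl_ex1[OF g this]]
  show "conn_form X H g v \<in> algd X (tgt X g)"
    and "right_transl X g (conn_form X H g v) = v - hor_lift X H g (?D v)"
    unfolding conn_form_def by (simp_all add: eq_diff_eq)
qed

text \<open>Permits the iterated quasi action in the theorem.\<close>

lemma quasi_algd_mem:
  assumes g: "g \<in> pts (Arr X)"
  shows "quasi_algd X H g \<alpha> \<in> algd X (tgt X g)"
  using conn_form(1)[OF g] linear_neg[OF differential_linear[OF charted_Arr src_smooth unit_mem[OF tgt_mem[OF g]]]]
  by (simp add: quasi_algd_def algd_def)

end

section \<open>Fundamental vector fields and the tangent action\<close>

context principal_bundle
begin

lemma charted_P: "charted_manifold P"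
  using P_manifold by (rule smooth_manifold.charted)

lemma act_mem [simp]:
  "p \<in> pts P \<Longrightarrow> g \<in> pts (Arr X) \<Longrightarrow> a p = tgt X g \<Longrightarrow> act p g \<in> pts P"
  using smooth_map_on_mem(2)[OF act_smooth, of "(p, g)"] by (simp add: fibre_prod_def)

lemmas anchor_mem [simp] = smooth_map_on_mem(2)[OF anchor_smooth]

declare anchor_act [simp]

lemma act_ginv_smooth:
  assumes "p \<in> pts P"
  shows "smooth_map_on (Arr X) P (src_fibre X (a p)) (\<lambda>h. act p (ginv X h))"
proof -
  have "smooth_map_on (Arr X) (prod_manifold P (Arr X)) (src_fibre X (a p)) (\<lambda>h. (p, ginv X h))"
    using assms smooth_map_on_subset[OF ginv_smooth src_fibre_subset]
    by (intro smooth_map_on_Pair smooth_map_on_const charted_Arr charted_P src_fibre_subset)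
  from smooth_map_on_compose[OF charted_Arr charted_prod[OF charted_P charted_Arr] this act_smooth]
  show ?thesis
    using assms by (simp add: fibre_prod_def image_subset_iff)
qed

lemma fund_vf_velocity:
  assumes "p \<in> pts P" and "\<gamma> 0 = unit_at X (a p)" and "has_velocity (Arr X) \<gamma> \<alpha>"
    and "\<forall>\<^sub>F t in nhds 0. \<gamma> t \<in> src_fibre X (a p)"
  shows "has_velocity P (\<lambda>t. act p (ginv X (\<gamma> t))) (fund_vf X P a act p \<alpha>)"
  using has_velocity_on[OF charted_Arr act_ginv_smooth[OF assms(1)] assms(3,4)] assms(2)
  by (simp add: fund_vf_def)

lemma fund_vf_linear:
  assumes "p \<in> pts P"
  shows "linear (fund_vf X P a act p)"
  unfolding fund_vf_def using assms
  by (intro differential_on_linear[OF charted_Arr act_ginv_smooth]) auto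

lemma tangent_act_velocity:
  assumes "has_velocity P \<rho> u" and "has_velocity (Arr X) \<gamma> \<beta>"
    and "\<forall>\<^sub>F t in nhds 0. \<rho> t \<in> pts P \<and> \<gamma> t \<in> pts (Arr X) \<and> a (\<rho> t) = tgt X (\<gamma> t)"
  shows "has_velocity P (\<lambda>t. act (\<rho> t) (\<gamma> t)) (tangent_act X P a act (\<rho> 0) (\<gamma> 0) u \<beta>)"
  using has_velocity_on[OF charted_prod[OF charted_P charted_Arr] act_smooth has_velocity_Pair[OF assms(1,2)]]
    assms(3) by (simp add: fibre_prod_def tangent_act_def)

text \<open>The tangent action is linear in the pair, not in each argument separately; the main
  computation splits a pair in this way.\<close>

lemma tangent_act_diff:
  assumes "p \<in> pts P" "g \<in> pts (Arr X)" "a p = tgt X g"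
  shows "tangent_act X P a act p g (u - u') (\<beta> - \<beta>') =
    tangent_act X P a act p g u \<beta> - tangent_act X P a act p g u' \<beta>'"
proof -
  have "linear (differential_on (prod_manifold P (Arr X)) P
      (fibre_prod (pts P) a (pts (Arr X)) (tgt X)) (\<lambda>(p, g). act p g) (p, g))"
    using assms by (intro differential_on_linear[OF charted_prod[OF charted_P charted_Arr] act_smooth])
      (simp add: fibre_prod_def)
  from linear_diff[OF this, of "(u, \<beta>)" "(u', \<beta>')"] show ?thesis
    by (simp add: tangent_act_def)
qed

end

section \<open>The intertwining identity\<close>

locale principal_bundle_connection = principal_bundle X P M \<pi> a act + groupoid_connection X H
  for X :: "('x, 'e0::real_normed_vector, 'g, 'e1::real_normed_vector) groupoid"
    and P :: "('p, 'ep::real_normed_vector) manifold"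
    and M :: "('m, 'em::real_normed_vector) manifold"
    and \<pi> a act H
begin

lemma fund_vf_quasi_equivariant:
  assumes p: "p \<in> pts P" and g: "g \<in> pts (Arr X)" and pg: "a p = tgt X g" and \<alpha>: "\<alpha> \<in> algd X (a p)"
  shows "fund_vf X P a act (act p g) (quasi_algd X H (ginv X g) \<alpha>) =
    quasi_tangent X H P a act p g (fund_vf X P a act p \<alpha>)"
proof -
  let ?g' = "ginv X g"
  let ?u = "fund_vf X P a act p \<alpha>" and ?l = "left_transl X ?g' \<alpha>"
  let ?di = "differential (Arr X) (Arr X) (ginv X) ?g'"
  let ?T = "tangent_act X P a act p g"
  define \<psi> where "\<psi> = conn_form X H ?g' ?l"
  have \<psi>: "\<psi> \<in> algd X (src X g)"
    using conn_form(1)[of ?g' ?l] g by (simp add: \<psi>_def)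
  have di: "linear ?di"
    using g by (intro differential_linear[OF charted_Arr ginv_smooth]) simp

  obtain \<gamma> where \<gamma>: "\<gamma> 0 = unit_at X (a p)" "has_velocity (Arr X) \<gamma> \<alpha>"
    and fib: "\<forall>\<^sub>F t in nhds 0. \<gamma> t \<in> src_fibre X (a p)"
    using algd_curve[OF anchor_mem[OF p] \<alpha>] .
  have u: "has_velocity P (\<lambda>t. act p (ginv X (\<gamma> t))) ?u"
    by (rule fund_vf_velocity[OF p \<gamma> fib])
  have l: "has_velocity (Arr X) (\<lambda>t. gcomp X ?g' (ginv X (\<gamma> t))) ?l"
    using left_transl_velocity[of ?g' \<gamma> \<alpha>] \<gamma> fib g pg by simp
  have base: "gcomp X ?g' (ginv X (\<gamma> 0)) = ?g'" "act p (ginv X (\<gamma> 0)) = p"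
    using g p pg act_unit[OF p] by (simp_all add: \<gamma>(1))

  \<comment> \<open>Anchor and source agree along the two curves: both take the value
    \<open>src X (ginv X (\<gamma> t))\<close>. Hence the lift in \<open>quasi_tangent\<close> is
    the horizontal part of \<open>?l\<close>.\<close>
  have anchor: "differential P (Obj X) a p ?u = differential (Arr X) (Obj X) (src X) ?g' ?l"
  proof (rule has_velocity_unique)
    show "has_velocity (Obj X) (\<lambda>t. a (act p (ginv X (\<gamma> t)))) (differential P (Obj X) a p ?u)"
      using has_velocity_smooth[OF charted_P anchor_smooth u] by (simp add: base)
    show "has_velocity (Obj X) (\<lambda>t. a (act p (ginv X (\<gamma> t))))
        (differential (Arr X) (Obj X) (src X) ?g' ?l)"
    proof (rule has_velocity_cong)
      show "has_velocity (Obj X) (\<lambda>t. src X (gcomp X ?g' (ginv X (\<gamma> t))))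
          (differential (Arr X) (Obj X) (src X) ?g' ?l)"
        using has_velocity_smooth[OF charted_Arr src_smooth l] by (simp add: base)
      show "\<forall>\<^sub>F t in nhds 0. src X (gcomp X ?g' (ginv X (\<gamma> t))) = a (act p (ginv X (\<gamma> t)))"
        using fib by eventually_elim (use p g pg in simp)
    qed
  qed

  \<comment> \<open>The product of the curves \<open>p \<gamma>\<^sup>-\<^sup>1\<close> and \<open>(g\<^sup>-\<^sup>1 \<gamma>\<^sup>-\<^sup>1)\<^sup>-\<^sup>1 = \<gamma> g\<close> is constant.\<close>
  have T0: "?T ?u (?di ?l) = 0"
  proof (rule has_velocity_unique)
    have v: "has_velocity (Arr X) (\<lambda>t. ginv X (gcomp X ?g' (ginv X (\<gamma> t)))) (?di ?l)"
      using has_velocity_smooth[OF charted_Arr ginv_smooth l] by (simp add: base)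
    have ev: "\<forall>\<^sub>F t in nhds 0. ginv X (gcomp X ?g' (ginv X (\<gamma> t))) = gcomp X (\<gamma> t) g"
      using fib by eventually_elim (use g pg in \<open>simp add: ginv_comp\<close>)
    show "has_velocity P (\<lambda>t. act (act p (ginv X (\<gamma> t))) (ginv X (gcomp X ?g' (ginv X (\<gamma> t))))) (?T ?u (?di ?l))"
    proof -
      have "\<forall>\<^sub>F t in nhds 0. act p (ginv X (\<gamma> t)) \<in> pts P \<and>
          ginv X (gcomp X ?g' (ginv X (\<gamma> t))) \<in> pts (Arr X) \<and>
          a (act p (ginv X (\<gamma> t))) = tgt X (ginv X (gcomp X ?g' (ginv X (\<gamma> t))))"
        using fib by eventually_elim (use g p pg in simp)
      from tangent_act_velocity[OF u v this] show ?thesis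
        using g by (simp add: base)
    qed
    show "has_velocity P (\<lambda>t. act (act p (ginv X (\<gamma> t))) (ginv X (gcomp X ?g' (ginv X (\<gamma> t))))) 0"
    proof (rule has_velocity_cong[OF has_velocity_const[OF charted_P, of "act p g"]])
      show "\<forall>\<^sub>F t in nhds 0. act p g = act (act p (ginv X (\<gamma> t))) (ginv X (gcomp X ?g' (ginv X (\<gamma> t))))"
        using fib ev
      proof eventually_elim
        case (elim t)
        have "gcomp X (ginv X (\<gamma> t)) (gcomp X (\<gamma> t) g) = gcomp X (gcomp X (ginv X (\<gamma> t)) (\<gamma> t)) g"
          using elim(1) g pg by (intro comp_assoc[symmetric]) auto
        also have "\<dots> = g"
          using elim(1) g pg by (simp add: comp_ginv_left)
        finally show ?case
          unfolding elim(2) using elim(1) p g pg by (simp add: act_comp)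
      qed
    qed (use p g pg in simp)
  qed

  \<comment> \<open>Along a curve \<open>\<kappa>\<close> with velocity \<open>\<psi>\<close>, \<open>(p g) \<kappa>\<^sup>-\<^sup>1 = p (\<kappa> g\<^sup>-\<^sup>1)\<^sup>-\<^sup>1\<close>.\<close>
  have T\<psi>: "?T 0 (?di (right_transl X ?g' \<psi>)) = fund_vf X P a act (act p g) \<psi>"
  proof -
    obtain \<kappa> where \<kappa>: "\<kappa> 0 = unit_at X (src X g)" "has_velocity (Arr X) \<kappa> \<psi>"
      and fib: "\<forall>\<^sub>F t in nhds 0. \<kappa> t \<in> src_fibre X (src X g)"
      using algd_curve[OF src_mem[OF g] \<psi>] .
    have r: "has_velocity (Arr X) (\<lambda>t. gcomp X (\<kappa> t) ?g') (right_transl X ?g' \<psi>)"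
      using right_transl_velocity[of ?g' \<kappa> \<psi>] \<kappa> fib g by simp
    have r0: "gcomp X (\<kappa> 0) ?g' = ?g'"
      using g by (simp add: \<kappa>(1))
    have v: "has_velocity (Arr X) (\<lambda>t. ginv X (gcomp X (\<kappa> t) ?g')) (?di (right_transl X ?g' \<psi>))"
      using has_velocity_smooth[OF charted_Arr ginv_smooth r] by (simp add: r0)
    have 1: "has_velocity P (\<lambda>t. act p (ginv X (gcomp X (\<kappa> t) ?g'))) (?T 0 (?di (right_transl X ?g' \<psi>)))"
    proof -
      have "\<forall>\<^sub>F t in nhds 0. p \<in> pts P \<and> ginv X (gcomp X (\<kappa> t) ?g') \<in> pts (Arr X) \<and>
          a p = tgt X (ginv X (gcomp X (\<kappa> t) ?g'))"
        using fib by eventually_elim (use g p pg in simp)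
      from tangent_act_velocity[OF has_velocity_const[OF charted_P p] v this] show ?thesis
        using g by (simp add: r0)
    qed
    have 2: "has_velocity P (\<lambda>t. act p (ginv X (gcomp X (\<kappa> t) ?g'))) (fund_vf X P a act (act p g) \<psi>)"
    proof (rule has_velocity_cong)
      show "has_velocity P (\<lambda>t. act (act p g) (ginv X (\<kappa> t))) (fund_vf X P a act (act p g) \<psi>)"
        using fund_vf_velocity[of "act p g" \<kappa> \<psi>] \<kappa> fib p g pg by simp
      show "\<forall>\<^sub>F t in nhds 0. act (act p g) (ginv X (\<kappa> t)) = act p (ginv X (gcomp X (\<kappa> t) ?g'))"
        using fib by eventually_elim (use g p pg in \<open>simp add: ginv_comp act_comp\<close>)
    qed
    from 1 2 show ?thesis
      by (rule has_velocity_unique)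
  qed

  have "quasi_tangent X H P a act p g ?u =
      ?T ?u (?di (hor_lift X H ?g' (differential (Arr X) (Obj X) (src X) ?g' ?l)))"
    by (simp add: quasi_tangent_def anchor)
  \<comment> \<open>The horizontal part of \<open>?l\<close> is \<open>?l\<close> minus the right
    translate of \<open>\<psi>\<close>. Writing \<open>?u - 0\<close> brings the pair into the form
    of \<open>tangent_act_diff\<close>, whose two terms are \<open>T0\<close> and
    \<open>T\<psi>\<close>.\<close>
  also have "\<dots> = ?T (?u - 0) (?di ?l - ?di (right_transl X ?g' \<psi>))"
    using conn_form(2)[of ?g' ?l] g by (simp add: \<psi>_def linear_diff[OF di])
  also have "\<dots> = - fund_vf X P a act (act p g) \<psi>"
    unfolding tangent_act_diff[OF p g pg] T0 T\<psi> by simp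
  also have "\<dots> = fund_vf X P a act (act p g) (quasi_algd X H ?g' \<alpha>)"
    using linear_neg[OF fund_vf_linear[OF act_mem[OF p g pg]]] by (simp add: quasi_algd_def \<psi>_def)
  finally show ?thesis ..
qed

end

theorem proposition13:
  fixes X :: "('x, 'e0::real_normed_vector, 'g, 'e1::real_normed_vector) groupoid"
    and P :: "('p, 'ep::real_normed_vector) manifold"
    and M :: "('m, 'em::real_normed_vector) manifold"
    and \<pi> :: "'p \<Rightarrow> 'm" and a :: "'p \<Rightarrow> 'x" and act :: "'p \<Rightarrow> 'g \<Rightarrow> 'p"
    and H :: "'g \<Rightarrow> 'e1 set"
    and p :: 'p and g h :: 'g and \<alpha> :: 'e1
  assumes "lie_groupoid X"
    and "principal_bundle X P M \<pi> a act"
    and "ehresmann_connection X H"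
    and "p \<in> pts P" and "g \<in> pts (Arr X)" and "h \<in> pts (Arr X)"
    and "a p = tgt X g" and "src X g = tgt X h"
    and "\<alpha> \<in> algd X (src X (ginv X g))"
  shows "fund_vf X P a act (act (act p g) h)
           (quasi_algd X H (gcomp X (ginv X h) (ginv X g)) \<alpha>
             - quasi_algd X H (ginv X h) (quasi_algd X H (ginv X g) \<alpha>))
         = quasi_tangent X H P a act p (gcomp X g h) (fund_vf X P a act p \<alpha>)
             - quasi_tangent X H P a act (act p g) h
                 (quasi_tangent X H P a act p g (fund_vf X P a act p \<alpha>))"
proof -
  interpret principal_bundle X P M \<pi> a act by fact
  interpret ehresmann_connection X H by fact
  interpret principal_bundle_connection X P M \<pi> a act H ..
  note [simp] = assms(4-8)
  have \<alpha>: "\<alpha> \<in> algd X (a p)"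
    using assms(9) by simp
  let ?\<beta> = "quasi_algd X H (ginv X g) \<alpha>"
  \<comment> \<open>The new element lies over the anchor of \<open>act p g\<close>, so the identity
    applies a second time, at that point and the arrow \<open>h\<close>.\<close>
  have "?\<beta> \<in> algd X (a (act p g))"
    using quasi_algd_mem[of "ginv X g" \<alpha>] by simp
  then have "fund_vf X P a act (act (act p g) h) (quasi_algd X H (ginv X h) ?\<beta>) =
      quasi_tangent X H P a act (act p g) h (quasi_tangent X H P a act p g (fund_vf X P a act p \<alpha>))"
    using fund_vf_quasi_equivariant[of "act p g" h ?\<beta>] fund_vf_quasi_equivariant[of p g \<alpha>] \<alpha> by simp
  \<comment> \<open>The instance for the product arrow fits because \<open>act_comp\<close> merges
    the two actions and \<open>ginv_comp\<close> reverses the order of the inverses.\<close>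
  moreover have "fund_vf X P a act (act (act p g) h) (quasi_algd X H (gcomp X (ginv X h) (ginv X g)) \<alpha>) =
      quasi_tangent X H P a act p (gcomp X g h) (fund_vf X P a act p \<alpha>)"
    using fund_vf_quasi_equivariant[of p "gcomp X g h" \<alpha>] \<alpha> by (simp add: ginv_comp act_comp)
  ultimately show ?thesis
    using linear_diff[OF fund_vf_linear[of "act (act p g) h"]] by simp
qed

end
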